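(* Let $U\subseteq\mathbb{C}_{xy}$ be $q$-open and $d,l\in\mathbb{Z}_+$. Consider the sequence $0\to\mathcal{Q}(U)\xrightarrow{\partial^0}\mathcal{Q}(U)\oplus\mathcal{Q}(U)\xrightarrow{\partial^1}\mathcal{Q}(U)\xrightarrow{\pi_{d,l}}\mathcal{O}(U)\to0$, where $\partial^0\zeta=\big((w_1-q^{l+1}w_2)\zeta,\ (z_2-q^{d+1}z_1)\zeta\big)$, $\partial^1(\zeta,\eta)=(z_2-q^dz_1)\zeta+(q^lw_2-w_1)\eta$, and $\pi_{d,l}(\zeta)=\big(\zeta_1(z,q^dz),\ \zeta_4(q^lw,w)\big)$. This is a cochain complex of Fréchet spaces and its cohomology groups $H^0,\dots,H^3$ satisfy: $H^0=\{0\}$ (i.e. $\partial^0$ is injective), $H^1=\ker\partial^1/\operatorname{im}\partial^0$ is topologically isomorphic to $\mathcal{O}(U)$ (in particular $\operatorname{im}\partial^0$ is closed), $H^2=\{0\}$ (i.e. $\operatorname{im}\partial^1=\ker\pi_{d,l}$, in particular closed), and $H^3=\{0\}$ (i.e. $\pi_{d,l}$ is surjective).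
   Context: Fix $q$ with $0<|q|<1$. $V\subseteq\mathbb{C}$ is $q$-open if open, $0\in V$, $qV\subseteq V$. A $q$-open $U\subseteq\mathbb{C}_{xy}=(\mathbb{C}\times\{0\})\cup(\{0\}\times\mathbb{C})$ is $U=U_x\cup U_y$ with $U_x,U_y$ $q$-open subsets of $\mathbb{C}$ (coordinate $z$ on $U_x$, $w$ on $U_y$). $\mathcal{O}(U)=\{(f,g)\in\mathcal{O}(U_x)\oplus\mathcal{O}(U_y):f(0)=g(0)\}$. $\mathcal{Q}(U)$ is the Fréchet space of quadruples $\zeta=(\zeta_1(z_1,z_2),\zeta_2(z_1,w_2),\zeta_3(w_1,z_2),\zeta_4(w_1,w_2))$ with $\zeta_1\in\mathcal{O}(U_x\times U_x)$, $\zeta_2\in\mathcal{O}(U_x\times U_y)$, $\zeta_3\in\mathcal{O}(U_y\times U_x)$, $\zeta_4\in\mathcal{O}(U_y\times U_y)$ satisfying $\zeta_1(z_1,0)=\zeta_2(z_1,0)$, $\zeta_3(w_1,0)=\zeta_4(w_1,0)$, $\zeta_1(0,z_2)=\zeta_3(0,z_2)$, $\zeta_2(0,w_2)=\zeta_4(0,w_2)$ (it is isomorphic to $\mathcal{O}(U)\widehat{\otimes}\mathcal{O}(U)$). The operators $z_1,z_2,w_1,w_2$ on $\mathcal{Q}(U)$ act by: $z_1\zeta=(z_1\zeta_1,z_1\zeta_2,0,0)$, $z_2\zeta=(z_2\zeta_1,0,z_2\zeta_3,0)$, $w_1\zeta=(0,0,w_1\zeta_3,w_1\zeta_4)$, $w_2\zeta=(0,w_2\zeta_2,0,w_2\zeta_4)$.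 *)

theory Defs
  imports "HOL-Analysis.Analysis"
begin

type_synonym fn1 = "complex \<Rightarrow> complex"
type_synonym fn2 = "complex \<times> complex \<Rightarrow> complex"
type_synonym quad = "(fn2 \<times> fn2) \<times> (fn2 \<times> fn2)"
type_synonym ofun = "fn1 \<times> fn1"

definition q_open :: "complex \<Rightarrow> complex set \<Rightarrow> bool" where
  "q_open q V \<longleftrightarrow> open V \<and> 0 \<in> V \<and> (\<lambda>z. q * z) ` V \<subseteq> V"

(* holomorphy in two complex variables: complex (Frechet) differentiability,
   i.e. the derivative is complex linear *)
definition holo2 :: "(complex \<times> complex) set \<Rightarrow> fn2 \<Rightarrow> bool" where
  "holo2 S f \<longleftrightarrow> (\<forall>p\<in>S. \<exists>a b. (f has_derivative (\<lambda>h. a * fst h + b * snd h)) (at p))"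

definition lcu_topology :: "'a::metric_space set \<Rightarrow> ('a \<Rightarrow> complex) topology" where
  "lcu_topology D = topology (\<lambda>S. \<forall>f\<in>S. \<exists>K e. compact K \<and> K \<subseteq> D \<and> e > 0 \<and>
      (\<forall>g. (\<forall>x\<in>K. dist (g x) (f x) \<le> e) \<longrightarrow> g \<in> S))"

(* functions are normalised to be 0 outside their domain *)
definition O_carrier :: "complex set \<Rightarrow> complex set \<Rightarrow> ofun set" where
  "O_carrier Ux Uy = {(f, g). f holomorphic_on Ux \<and> g holomorphic_on Uy \<and>
      (\<forall>z. z \<notin> Ux \<longrightarrow> f z = 0) \<and> (\<forall>w. w \<notin> Uy \<longrightarrow> g w = 0) \<and> f 0 = g 0}"

definition O_top :: "complex set \<Rightarrow> complex set \<Rightarrow> ofun topology" where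
  "O_top Ux Uy = subtopology (prod_topology (lcu_topology Ux) (lcu_topology Uy)) (O_carrier Ux Uy)"

definition Q_carrier :: "complex set \<Rightarrow> complex set \<Rightarrow> quad set" where
  "Q_carrier Ux Uy = {((z1, z2), (z3, z4)).
      holo2 (Ux \<times> Ux) z1 \<and> holo2 (Ux \<times> Uy) z2 \<and> holo2 (Uy \<times> Ux) z3 \<and> holo2 (Uy \<times> Uy) z4 \<and>
      (\<forall>p. p \<notin> Ux \<times> Ux \<longrightarrow> z1 p = 0) \<and> (\<forall>p. p \<notin> Ux \<times> Uy \<longrightarrow> z2 p = 0) \<and>
      (\<forall>p. p \<notin> Uy \<times> Ux \<longrightarrow> z3 p = 0) \<and> (\<forall>p. p \<notin> Uy \<times> Uy \<longrightarrow> z4 p = 0) \<and>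
      (\<forall>a\<in>Ux. z1 (a, 0) = z2 (a, 0)) \<and> (\<forall>a\<in>Uy. z3 (a, 0) = z4 (a, 0)) \<and>
      (\<forall>a\<in>Ux. z1 (0, a) = z3 (0, a)) \<and> (\<forall>a\<in>Uy. z2 (0, a) = z4 (0, a))}"

definition Q_top :: "complex set \<Rightarrow> complex set \<Rightarrow> quad topology" where
  "Q_top Ux Uy = subtopology
     (prod_topology (prod_topology (lcu_topology (Ux \<times> Ux)) (lcu_topology (Ux \<times> Uy)))
                    (prod_topology (lcu_topology (Uy \<times> Ux)) (lcu_topology (Uy \<times> Uy))))
     (Q_carrier Ux Uy)"

definition QQ_top :: "complex set \<Rightarrow> complex set \<Rightarrow> (quad \<times> quad) topology" where
  "QQ_top Ux Uy = prod_topology (Q_top Ux Uy) (Q_top Ux Uy)"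

definition qzero :: quad where "qzero = (((\<lambda>_. 0), (\<lambda>_. 0)), ((\<lambda>_. 0), (\<lambda>_. 0)))"

definition qadd :: "quad \<Rightarrow> quad \<Rightarrow> quad" where
  "qadd x y = (case x of ((a1, a2), (a3, a4)) \<Rightarrow> case y of ((b1, b2), (b3, b4)) \<Rightarrow>
     (((\<lambda>p. a1 p + b1 p), (\<lambda>p. a2 p + b2 p)), ((\<lambda>p. a3 p + b3 p), (\<lambda>p. a4 p + b4 p))))"

definition qscale :: "complex \<Rightarrow> quad \<Rightarrow> quad" where
  "qscale c x = (case x of ((a1, a2), (a3, a4)) \<Rightarrow>
     (((\<lambda>p. c * a1 p), (\<lambda>p. c * a2 p)), ((\<lambda>p. c * a3 p), (\<lambda>p. c * a4 p))))"

definition ozero :: ofun where "ozero = ((\<lambda>_. 0), (\<lambda>_. 0))"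

definition oadd :: "ofun \<Rightarrow> ofun \<Rightarrow> ofun" where
  "oadd x y = ((\<lambda>z. fst x z + fst y z), (\<lambda>w. snd x w + snd y w))"

definition oscale :: "complex \<Rightarrow> ofun \<Rightarrow> ofun" where
  "oscale c x = ((\<lambda>z. c * fst x z), (\<lambda>w. c * snd x w))"

(* the operators z1, z2, w1, w2 on Q(U); zeta2 = zeta2(z1,w2), zeta3 = zeta3(w1,z2) *)
definition opz1 :: "quad \<Rightarrow> quad" where
  "opz1 x = (case x of ((a1, a2), (a3, a4)) \<Rightarrow>
     (((\<lambda>p. fst p * a1 p), (\<lambda>p. fst p * a2 p)), ((\<lambda>_. 0), (\<lambda>_. 0))))"

definition opz2 :: "quad \<Rightarrow> quad" where
  "opz2 x = (case x of ((a1, a2), (a3, a4)) \<Rightarrow>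
     (((\<lambda>p. snd p * a1 p), (\<lambda>_. 0)), ((\<lambda>p. snd p * a3 p), (\<lambda>_. 0))))"

definition opw1 :: "quad \<Rightarrow> quad" where
  "opw1 x = (case x of ((a1, a2), (a3, a4)) \<Rightarrow>
     (((\<lambda>_. 0), (\<lambda>_. 0)), ((\<lambda>p. fst p * a3 p), (\<lambda>p. fst p * a4 p))))"

definition opw2 :: "quad \<Rightarrow> quad" where
  "opw2 x = (case x of ((a1, a2), (a3, a4)) \<Rightarrow>
     (((\<lambda>_. 0), (\<lambda>p. snd p * a2 p)), ((\<lambda>_. 0), (\<lambda>p. snd p * a4 p))))"

definition dd0 :: "complex \<Rightarrow> nat \<Rightarrow> nat \<Rightarrow> quad \<Rightarrow> quad \<times> quad" where
  "dd0 q d l x = (qadd (opw1 x) (qscale (- (q ^ (l + 1))) (opw2 x)),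
                  qadd (opz2 x) (qscale (- (q ^ (d + 1))) (opz1 x)))"

definition dd1 :: "complex \<Rightarrow> nat \<Rightarrow> nat \<Rightarrow> quad \<times> quad \<Rightarrow> quad" where
  "dd1 q d l p = qadd (qadd (opz2 (fst p)) (qscale (- (q ^ d)) (opz1 (fst p))))
                      (qadd (qscale (q ^ l) (opw2 (snd p))) (qscale (-1) (opw1 (snd p))))"

definition pi_dl :: "complex \<Rightarrow> nat \<Rightarrow> nat \<Rightarrow> complex set \<Rightarrow> complex set \<Rightarrow> quad \<Rightarrow> ofun" where
  "pi_dl q d l Ux Uy x =
     ((\<lambda>z. if z \<in> Ux then fst (fst x) (z, q ^ d * z) else 0),
      (\<lambda>w. if w \<in> Uy then snd (snd x) (q ^ l * w, w) else 0))"

end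

theory Submission
  imports Defs "HOL-Complex_Analysis.Complex_Analysis"
begin

text \<open>Everything reduces to one division principle: a holomorphic function of two variables that
  vanishes on a line through the origin is divisible by the linear form of that line. Exactness at
  the middle and last terms is then a matter of solving the four component equations and gluing the
  solutions along the axes. For the first cohomology, a pair in the kernel of \<open>dd1\<close> is determined
  modulo coboundaries by the restrictions of \<open>eta1\<close> and \<open>zeta4\<close> to the lines
  \<open>z2 = q\<^sup>d\<^sup>+\<^sup>1 * z1\<close> and \<open>w1 = q\<^sup>l\<^sup>+\<^sup>1 * w2\<close>. Both restrictions vanish at 0, and after division by
  the coordinate (and rescaling) they form an arbitrary element of \<open>O(U)\<close>. Division by the
  coordinate is continuous by the maximum modulus principle, and this map has a continuous linear
  section built from \<open>F(z) + G(w) - F(0)\<close>, so it is a quotient map.\<close>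

section \<open>Holomorphic functions of two variables\<close>

text \<open>\<open>Ux\<close> and \<open>Uy\<close> are merely open sets around 0 that are stable
  under multiplication by \<open>q\<close>; they need be neither discs nor connected. Global power
  series and the identity theorem are therefore out of reach. Linear factors are cancelled slice by
  slice, through continuity at the single zero of the factor, and quotients are recognised as
  holomorphic by Osgood's lemma. The shape of the first cohomology comes from a mismatch of lines. A
  cocycle has \<open>zeta1 = 0\<close> and \<open>eta4 = 0\<close>, while \<open>eta1\<close> and
  \<open>zeta4\<close> do not occur in \<open>dd1\<close> at all and are tied down only by gluing
  along the axes. In a coboundary these two components carry the factors
  \<open>z2 - q ^ (d + 1) * z1\<close> and \<open>w1 - q ^ (l + 1) * w2\<close>. So one function on
  \<open>Ux\<close> and one on \<open>Uy\<close> obstruct, and gluing leaves a single relation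
  between them at 0, which is the relation defining \<open>O(U)\<close>.\<close>

lemma holo2_imp_continuous_on:
  assumes "holo2 S f"
  shows "continuous_on S f"
  using assms unfolding holo2_def
  by (meson continuous_at_imp_continuous_on has_derivative_continuous)

lemma holo2_cong:
  assumes "holo2 S f" "open S" "\<And>p. p \<in> S \<Longrightarrow> g p = f p"
  shows "holo2 S g"
  unfolding holo2_def
proof
  fix p assume p: "p \<in> S"
  then obtain a b where "(f has_derivative (\<lambda>h. a * fst h + b * snd h)) (at p)"
    using assms(1) unfolding holo2_def by blast
  then have "(g has_derivative (\<lambda>h. a * fst h + b * snd h)) (at p)"
    by (rule has_derivative_transform_within_open[OF _ assms(2) p]) (simp add: assms(3))
  then show "\<exists>a b. (g has_derivative (\<lambda>h. a * fst h + b * snd h)) (at p)" by blast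
qed

lemma holo2_const [simp]: "holo2 S (\<lambda>p. c)"
  unfolding holo2_def
proof
  fix p :: "complex \<times> complex" assume "p \<in> S"
  have "((\<lambda>p. c) has_derivative (\<lambda>h. 0 * fst h + 0 * snd h)) (at p)"
    by (auto intro!: derivative_eq_intros)
  then show "\<exists>a b. ((\<lambda>p. c) has_derivative (\<lambda>h. a * fst h + b * snd h)) (at p)" by blast
qed

lemma holo2_add:
  assumes "holo2 S f" "holo2 S g"
  shows "holo2 S (\<lambda>p. f p + g p)"
  unfolding holo2_def
proof
  fix p assume p: "p \<in> S"
  obtain a b where 1: "(f has_derivative (\<lambda>h. a * fst h + b * snd h)) (at p)"
    using assms(1) p unfolding holo2_def by blast
  obtain c d where 2: "(g has_derivative (\<lambda>h. c * fst h + d * snd h)) (at p)"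
    using assms(2) p unfolding holo2_def by blast
  have "((\<lambda>p. f p + g p) has_derivative (\<lambda>h. (a + c) * fst h + (b + d) * snd h)) (at p)"
    by (rule has_derivative_eq_rhs[OF has_derivative_add[OF 1 2]]) (simp add: algebra_simps)
  then show "\<exists>a b. ((\<lambda>p. f p + g p) has_derivative (\<lambda>h. a * fst h + b * snd h)) (at p)" by blast
qed

lemma holo2_mult:
  assumes "holo2 S f" "holo2 S g"
  shows "holo2 S (\<lambda>p. f p * g p)"
  unfolding holo2_def
proof
  fix p assume p: "p \<in> S"
  obtain a b where 1: "(f has_derivative (\<lambda>h. a * fst h + b * snd h)) (at p)"
    using assms(1) p unfolding holo2_def by blast
  obtain c d where 2: "(g has_derivative (\<lambda>h. c * fst h + d * snd h)) (at p)"
    using assms(2) p unfolding holo2_def by blast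
  have "((\<lambda>p. f p * g p) has_derivative
      (\<lambda>h. (f p * c + a * g p) * fst h + (f p * d + b * g p) * snd h)) (at p)"
    by (rule has_derivative_eq_rhs[OF has_derivative_mult[OF 1 2]]) (simp add: algebra_simps)
  then show "\<exists>a b. ((\<lambda>p. f p * g p) has_derivative (\<lambda>h. a * fst h + b * snd h)) (at p)" by blast
qed

lemma holo2_minus: "holo2 S f \<Longrightarrow> holo2 S (\<lambda>p. - f p)"
  using holo2_mult[OF holo2_const[of S "-1"]] by simp

lemma holo2_diff: "holo2 S f \<Longrightarrow> holo2 S g \<Longrightarrow> holo2 S (\<lambda>p. f p - g p)"
  using holo2_add[OF _ holo2_minus] by simp

lemma holo2_fst: "holo2 S fst"
  unfolding holo2_def
proof
  fix p :: "complex \<times> complex" assume "p \<in> S"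
  have "(fst has_derivative (\<lambda>h. 1 * fst h + 0 * snd h)) (at p)"
    by (auto intro!: derivative_eq_intros)
  then show "\<exists>a b. (fst has_derivative (\<lambda>h. a * fst h + b * snd h)) (at p)" by blast
qed

lemma holo2_snd: "holo2 S snd"
  unfolding holo2_def
proof
  fix p :: "complex \<times> complex" assume "p \<in> S"
  have "(snd has_derivative (\<lambda>h. 0 * fst h + 1 * snd h)) (at p)"
    by (auto intro!: derivative_eq_intros)
  then show "\<exists>a b. (snd has_derivative (\<lambda>h. a * fst h + b * snd h)) (at p)" by blast
qed

lemma holo2_compose_holomorphic:
  assumes "holo2 S h" "f holomorphic_on A" "open A" "h ` S \<subseteq> A"
  shows "holo2 S (\<lambda>p. f (h p))"
  unfolding holo2_def
proof
  fix p assume p: "p \<in> S"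
  obtain a b where 1: "(h has_derivative (\<lambda>h. a * fst h + b * snd h)) (at p)"
    using assms(1) p unfolding holo2_def by blast
  have "(f has_field_derivative deriv f (h p)) (at (h p))"
    using assms p by (meson holomorphic_derivI image_subset_iff)
  then have "(f has_derivative (*) (deriv f (h p))) (at (h p))"
    by (simp add: has_field_derivative_def)
  from has_derivative_compose[OF 1 this]
  have "((\<lambda>p. f (h p)) has_derivative
      (\<lambda>x. (deriv f (h p) * a) * fst x + (deriv f (h p) * b) * snd x)) (at p)"
    by (rule has_derivative_eq_rhs) (simp add: algebra_simps)
  then show "\<exists>a b. ((\<lambda>p. f (h p)) has_derivative (\<lambda>h. a * fst h + b * snd h)) (at p)" by blast
qed

lemma holo2_compose_pair:
  assumes "holo2 T f" "holo2 S g" "holo2 S h" "\<And>p. p \<in> S \<Longrightarrow> (g p, h p) \<in> T"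
  shows "holo2 S (\<lambda>p. f (g p, h p))"
  unfolding holo2_def
proof
  fix p assume p: "p \<in> S"
  obtain a b where 1: "(g has_derivative (\<lambda>h. a * fst h + b * snd h)) (at p)"
    using assms(2) p unfolding holo2_def by blast
  obtain c d where 2: "(h has_derivative (\<lambda>h. c * fst h + d * snd h)) (at p)"
    using assms(3) p unfolding holo2_def by blast
  obtain r s where 3: "(f has_derivative (\<lambda>h. r * fst h + s * snd h)) (at (g p, h p))"
    using assms(1,4) p unfolding holo2_def by blast
  from has_derivative_compose[OF has_derivative_Pair[OF 1 2] 3]
  have "((\<lambda>p. f (g p, h p)) has_derivative
      (\<lambda>x. (r * a + s * c) * fst x + (r * b + s * d) * snd x)) (at p)"
    by (rule has_derivative_eq_rhs) (simp add: algebra_simps)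
  then show "\<exists>a b. ((\<lambda>p. f (g p, h p)) has_derivative (\<lambda>h. a * fst h + b * snd h)) (at p)" by blast
qed

lemma holo2_curve_derivative:
  assumes "(f has_derivative (\<lambda>h. a * fst h + b * snd h)) (at (g z, h z))"
    and "(g has_field_derivative g') (at z)" "(h has_field_derivative h') (at z)"
  shows "((\<lambda>z. f (g z, h z)) has_field_derivative (a * g' + b * h')) (at z)"
proof -
  have "((\<lambda>z. (g z, h z)) has_derivative (\<lambda>x. (g' * x, h' * x))) (at z)"
    using assms(2,3) unfolding has_field_derivative_def by (rule has_derivative_Pair)
  from has_derivative_compose[OF this assms(1)]
  show ?thesis unfolding has_field_derivative_def
    by (rule has_derivative_eq_rhs) (simp add: algebra_simps fun_eq_iff)
qed

lemma holo2_curve_holomorphic: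
  assumes "holo2 S f" "open A" "g holomorphic_on A" "h holomorphic_on A"
    and "\<And>z. z \<in> A \<Longrightarrow> (g z, h z) \<in> S"
  shows "(\<lambda>z. f (g z, h z)) holomorphic_on A"
  unfolding holomorphic_on_open[OF \<open>open A\<close>]
proof
  fix z assume z: "z \<in> A"
  obtain a b where "(f has_derivative (\<lambda>h. a * fst h + b * snd h)) (at (g z, h z))"
    using assms(1,5) z unfolding holo2_def by blast
  from holo2_curve_derivative[OF this holomorphic_derivI[OF assms(3,2) z] holomorphic_derivI[OF assms(4,2) z]]
  show "\<exists>f'. ((\<lambda>z. f (g z, h z)) has_field_derivative f') (at z)" by blast
qed

text \<open>Cauchy's inequality bounds the change of the partial derivative under a move in the first
  variable by the change of the function on a compact circle.\<close>

lemma continuous_on_partial_deriv_snd: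
  fixes f :: fn2
  assumes A: "open A" and B: "open B" and cont: "continuous_on (A \<times> B) f"
    and hol: "\<And>z. z \<in> A \<Longrightarrow> (\<lambda>w. f (z, w)) holomorphic_on B"
  shows "continuous_on (A \<times> B) (\<lambda>p. deriv (\<lambda>w. f (fst p, w)) (snd p))"
    (is "continuous_on _ ?D")
proof -
  have "isCont ?D p0" if p0: "p0 \<in> A \<times> B" for p0
  proof -
    obtain z0 w0 where p0_eq: "p0 = (z0, w0)" and z0: "z0 \<in> A" and w0: "w0 \<in> B"
      using p0 by auto
    \<comment> \<open>The radius \<open>2 * r\<close> lets the disc of radius \<open>r\<close> about
      every \<open>w\<close> within \<open>r\<close> of \<open>w0\<close> stay inside one fixed
      compact disc, on which the estimate in the first variable is uniform.\<close>
    obtain r where r: "r > 0" "cball w0 (2 * r) \<subseteq> B"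
    proof -
      obtain s where "s > 0" "cball w0 s \<subseteq> B" using B w0 open_contains_cball by blast
      then show ?thesis using that[of "s/2"] by simp
    qed
    have "(\<lambda>w. deriv (\<lambda>w. f (z0, w)) w) holomorphic_on B"
      using hol[OF z0] B by (rule holomorphic_deriv)
    then have D0: "isCont (\<lambda>w. deriv (\<lambda>w. f (z0, w)) w) w0"
      using B w0 by (metis continuous_on_eq_continuous_at holomorphic_on_imp_continuous_on)
    show ?thesis unfolding p0_eq continuous_at_eps_delta
    proof (intro allI impI)
      fix e :: real assume e: "e > 0"
      \<comment> \<open>Cauchy's inequality on a circle of radius \<open>r\<close> divides by
        \<open>r\<close>, so \<open>e1\<close> contributes \<open>e / 4\<close>; the slice over
        \<open>z0\<close> contributes less than \<open>e / 2\<close>.\<close>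
      define e1 where "e1 = e * r / 4"
      have e1: "e1 > 0" using e r by (simp add: e1_def)
      obtain X0 where X0: "z0 \<in> X0" "open X0"
        "\<forall>x\<in>X0 \<inter> A. \<forall>t\<in>cball w0 (2 * r). dist (f (x, t)) (f (z0, t)) \<le> e1"
      proof (rule continuous_on_prod_compactE[of A "cball w0 (2*r)" f z0 e1])
        show "continuous_on (A \<times> cball w0 (2 * r)) f"
          using cont by (rule continuous_on_subset) (use r(2) in auto)
      qed (use z0 e1 in auto)
      obtain d1 where d1: "d1 > 0" "ball z0 d1 \<subseteq> X0 \<inter> A"
        using X0 A z0 by (meson IntI open_Int open_contains_ball)
      obtain d2 where d2: "d2 > 0" "\<And>w. dist w w0 < d2 \<Longrightarrow>
           dist (deriv (\<lambda>w. f (z0, w)) w) (deriv (\<lambda>w. f (z0, w)) w0) < e / 2"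
        using D0 e unfolding continuous_at_eps_delta by (meson half_gt_zero)
      define dl where "dl = min d1 (min d2 r)"
      show "\<exists>d>0. \<forall>x'. dist x' (z0, w0) < d \<longrightarrow> dist (?D x') (?D (z0, w0)) < e"
      proof (intro exI[of _ dl] conjI allI impI)
        show "dl > 0" using d1 d2 r by (simp add: dl_def)
        fix p assume p: "dist p (z0, w0) < dl"
        obtain z w where p_eq: "p = (z, w)" by (cases p)
        have dz: "dist z z0 < dl" and dw: "dist w w0 < dl"
          using p dist_fst_le[of p "(z0,w0)"] dist_snd_le[of p "(z0,w0)"] p_eq by auto
        have z: "z \<in> X0 \<inter> A" using dz d1 by (auto simp: dl_def dist_commute)
        have wr: "cball w r \<subseteq> cball w0 (2 * r)"
          using dw by (intro subsetI) (smt (verit) dl_def dist_commute dist_triangle mem_cball)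
        have sub: "cball w r \<subseteq> B" using wr r(2) by blast
        have h1: "(\<lambda>u. f (z, u)) holomorphic_on B" and h2: "(\<lambda>u. f (z0, u)) holomorphic_on B"
          using hol z z0 by auto
        have wB: "w \<in> B" using sub r(1) by (simp add: subset_iff)
        have "norm ((deriv ^^ 1) (\<lambda>u. f (z, u) - f (z0, u)) w) \<le> fact 1 * e1 / r ^ 1"
        proof (rule Cauchy_inequality[OF _ _ r(1)])
          have "(\<lambda>u. f (z, u) - f (z0, u)) holomorphic_on cball w r"
            by (intro holomorphic_on_diff holomorphic_on_subset[OF h1 sub] holomorphic_on_subset[OF h2 sub])
          then show "(\<lambda>u. f (z, u) - f (z0, u)) holomorphic_on ball w r"
            "continuous_on (cball w r) (\<lambda>u. f (z, u) - f (z0, u))"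
            by (auto intro: holomorphic_on_subset holomorphic_on_imp_continuous_on)
          fix x assume "norm (w - x) = r"
          then have "x \<in> cball w0 (2 * r)" using wr by (auto simp: dist_norm)
          then show "norm (f (z, x) - f (z0, x)) \<le> e1"
            using X0(3) z by (auto simp: dist_norm)
        qed
        moreover have "deriv (\<lambda>u. f (z, u) - f (z0, u)) w = deriv (\<lambda>u. f (z, u)) w - deriv (\<lambda>u. f (z0, u)) w"
          using h1 h2 B wB by (intro deriv_diff) (auto simp: holomorphic_on_open field_differentiable_def)
        ultimately have "dist (deriv (\<lambda>u. f (z, u)) w) (deriv (\<lambda>u. f (z0, u)) w) \<le> e / 4"
          using r by (simp add: dist_norm e1_def)
        moreover have "dist (deriv (\<lambda>w. f (z0, w)) w) (deriv (\<lambda>w. f (z0, w)) w0) < e / 2"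
          using d2 dw by (simp add: dl_def)
        ultimately have "dist (deriv (\<lambda>u. f (z, u)) w) (deriv (\<lambda>w. f (z0, w)) w0) < e"
          using e dist_triangle[of "deriv (\<lambda>u. f (z, u)) w" "deriv (\<lambda>w. f (z0, w)) w0" "deriv (\<lambda>u. f (z0, u)) w"]
          by linarith
        then show "dist (?D p) (?D (z0, w0)) < e" by (simp add: p_eq)
      qed
    qed
  qed
  then show ?thesis by (simp add: continuous_at_imp_continuous_on)
qed

text \<open>Joint continuity makes the partial derivative in the second variable continuous, and one
  continuous partial derivative together with the mere existence of the other already yields the
  total derivative. This is the test applied to quotients, whose differentiability on the zero line
  of the denominator is not directly visible.\<close>

lemma Osgood:
  fixes f :: fn2
  assumes A: "open A" and B: "open B" and cont: "continuous_on (A \<times> B) f"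
    and holz: "\<And>w. w \<in> B \<Longrightarrow> (\<lambda>z. f (z, w)) holomorphic_on A"
    and holw: "\<And>z. z \<in> A \<Longrightarrow> (\<lambda>w. f (z, w)) holomorphic_on B"
  shows "holo2 (A \<times> B) f"
  unfolding holo2_def
proof
  fix p assume p: "p \<in> A \<times> B"
  obtain z0 w0 where p_eq: "p = (z0, w0)" and z0: "z0 \<in> A" and w0: "w0 \<in> B"
    using p by auto
  \<comment> \<open>The rule on partial derivatives needs a convex set in the second variable, hence
    a ball in place of \<open>B\<close>.\<close>
  obtain r where r: "r > 0" "ball w0 r \<subseteq> B" using B w0 open_contains_ball by blast
  define D where "D p = deriv (\<lambda>w. f (fst p, w)) (snd p)" for p
  have D: "continuous_on (A \<times> B) D"
    unfolding D_def by (rule continuous_on_partial_deriv_snd[OF A B cont holw])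
  let ?fz = "deriv (\<lambda>z. f (z, w0)) z0"
  have "((\<lambda>(x, y). f (x, y)) has_derivative
      (\<lambda>(tx, ty). ?fz * tx + blinfun_apply (blinfun_mult_right (D (z0, w0))) ty))
      (at (z0, w0) within A \<times> ball w0 r)"
  proof (rule has_derivative_partialsI[where fy = "\<lambda>z w. blinfun_mult_right (D (z, w))"])
    show "((\<lambda>x. f (x, w0)) has_derivative (*) ?fz) (at z0 within A)"
      using holomorphic_derivI[OF holz[OF w0] A z0]
      by (simp add: has_field_derivative_def has_derivative_at_withinI)
    fix x y assume x: "x \<in> A" and y: "y \<in> ball w0 r"
    then have "y \<in> B" using r by blast
    from holomorphic_derivI[OF holw[OF x] B this]
    show "((\<lambda>y. f (x, y)) has_derivative blinfun_apply (blinfun_mult_right (D (x, y)))) (at y within ball w0 r)"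
      by (simp add: has_field_derivative_def has_derivative_at_withinI D_def)
  next
    have "isCont D (z0, w0)" using D p p_eq A B
      by (simp add: continuous_on_eq_continuous_at open_Times)
    then have "isCont (\<lambda>p. blinfun_mult_right (D p)) (z0, w0)"
      by (rule bounded_linear.isCont[OF bounded_linear_blinfun_mult_right])
    then show "continuous (at (z0, w0) within A \<times> ball w0 r) (\<lambda>(x, y). blinfun_mult_right (D (x, y)))"
      by (simp add: case_prod_unfold continuous_at_imp_continuous_at_within)
  qed (use r in auto)
  moreover have "at (z0, w0) within A \<times> ball w0 r = at p"
    unfolding p_eq using z0 r A by (intro at_within_open) (auto simp: open_Times)
  ultimately have "(f has_derivative (\<lambda>h. ?fz * fst h + D (z0, w0) * snd h)) (at p)"
    by (simp only: case_prod_unfold prod.collapse blinfun_mult_right.rep_eq)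
  then show "\<exists>a b. (f has_derivative (\<lambda>h. a * fst h + b * snd h)) (at p)" by blast
qed

text \<open>Off the line the quotient is given; on the line the partial derivative in the second
  variable fills it in. Joint continuity and holomorphy in each variable then give
  \<open>holo2\<close> by \<open>Osgood\<close>. The line may miss a slice (\<open>k * z\<close>
  outside \<open>B\<close>) or contain a whole slice (\<open>k = 0\<close>), which forces the case
  distinctions.\<close>

lemma holo2_divide_line_snd:
  fixes F :: fn2
  assumes A: "open A" and B: "open B" and F: "holo2 (A \<times> B) F"
    and zero: "\<And>z. z \<in> A \<Longrightarrow> k * z \<in> B \<Longrightarrow> F (z, k * z) = 0"
  obtains g where "holo2 (A \<times> B) g" "\<And>z w. z \<in> A \<Longrightarrow> w \<in> B \<Longrightarrow> F (z, w) = (w - k * z) * g (z, w)"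
proof -
  define D where "D p = deriv (\<lambda>w. F (fst p, w)) (snd p)" for p
  define g where "g p = (if snd p = k * fst p then D p else F p / (snd p - k * fst p))" for p
  have contF: "continuous_on (A \<times> B) F" by (rule holo2_imp_continuous_on[OF F])
  have Fw: "(\<lambda>w. F (z, w)) holomorphic_on B" if "z \<in> A" for z
    by (rule holo2_curve_holomorphic[OF F B]) (use that in \<open>auto intro!: holomorphic_intros\<close>)
  have Fz: "(\<lambda>z. F (z, w)) holomorphic_on A" if "w \<in> B" for w
    by (rule holo2_curve_holomorphic[OF F A]) (use that in \<open>auto intro!: holomorphic_intros\<close>)
  have D: "continuous_on (A \<times> B) D"
    unfolding D_def by (rule continuous_on_partial_deriv_snd[OF A B contF Fw])
  have AB: "open (A \<times> B)" using A B by (simp add: open_Times)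
  have holw: "(\<lambda>w. g (z, w)) holomorphic_on B" if z: "z \<in> A" for z
  proof (cases "k * z \<in> B")
    case True
    show ?thesis
      using pole_lemma_open[OF Fw[OF z] B, of "k * z"] zero[OF z True]
      by (auto simp: g_def D_def elim: holomorphic_transform)
  next
    case False
    have "(\<lambda>w. F (z, w) / (w - k * z)) holomorphic_on B"
      using False by (intro holomorphic_intros Fw z) auto
    then show ?thesis by (rule holomorphic_transform) (use False in \<open>auto simp: g_def\<close>)
  qed
  have contg: "continuous_on (A \<times> B) g"
  proof -
    have "isCont g (z0, w0)" if z0: "z0 \<in> A" and w0: "w0 \<in> B" for z0 w0
    proof (cases "w0 = k * z0")
      case False
      have "isCont F (z0, w0)" using contF AB z0 w0 by (simp add: continuous_on_eq_continuous_at)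
      then have "isCont (\<lambda>p. F p / (snd p - k * fst p)) (z0, w0)"
        using False by (intro continuous_intros) auto
      moreover have "\<forall>\<^sub>F p in nhds (z0, w0). F p / (snd p - k * fst p) = g p"
      proof -
        have "open {p :: complex \<times> complex. snd p \<noteq> k * fst p}"
          by (intro open_Collect_neq continuous_intros)
        then have "\<forall>\<^sub>F p in nhds (z0, w0). snd p \<noteq> k * fst p"
          using False by (auto simp: eventually_nhds)
        then show ?thesis by eventually_elim (simp add: g_def)
      qed
      ultimately show ?thesis by (simp add: isCont_cong)
    next
      case True
      have contD: "isCont D (z0, w0)" using D AB z0 w0 by (simp add: continuous_on_eq_continuous_at)
      show ?thesis unfolding continuous_at_eps_delta
      proof (intro allI impI)
        fix e :: real assume e: "e > 0"
        obtain d1 where d1: "d1 > 0" "\<And>p. dist p (z0, w0) < d1 \<Longrightarrow> dist (D p) (D (z0, w0)) < e / 2"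
          using contD e unfolding continuous_at_eps_delta by (meson half_gt_zero)
        obtain d2 where d2: "d2 > 0" "ball z0 d2 \<subseteq> A" using A z0 open_contains_ball by blast
        obtain d3 where d3: "d3 > 0" "ball w0 d3 \<subseteq> B" using B w0 open_contains_ball by blast
        \<comment> \<open>\<open>t\<close> is at most half of \<open>d1\<close>, so that
          displacements below \<open>t\<close> in both variables together stay below
          \<open>d1\<close>. The factor \<open>1 + norm k\<close> in \<open>s\<close> gives both
          \<open>s \<le> t\<close> and \<open>norm k * s < t\<close>, so that \<open>w\<close> and
          \<open>k * z\<close> lie in the same ball about \<open>w0 = k * z0\<close>.\<close>
        define t where "t = min (d1 / 2) (min d2 d3)"
        have t: "t > 0" using d1 d2 d3 by (simp add: t_def)
        define s where "s = t / (1 + norm k)"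
        have nk: "1 + norm k > 0" by (smt (verit) norm_ge_zero)
        have s: "s > 0" using t nk by (simp add: s_def)
        have ks: "norm k * s < t" using t nk by (simp add: s_def field_simps)
        have st: "s \<le> t" using t nk by (simp add: s_def field_simps)
        show "\<exists>d>0. \<forall>x'. dist x' (z0, w0) < d \<longrightarrow> dist (g x') (g (z0, w0)) < e"
        proof (intro exI[of _ s] conjI allI impI)
          fix p assume p: "dist p (z0, w0) < s"
          obtain z w where p_eq: "p = (z, w)" by (cases p)
          have dz: "dist z z0 < s" and dw: "dist w w0 < s"
            using p dist_fst_le[of p "(z0,w0)"] dist_snd_le[of p "(z0,w0)"] p_eq by auto
          have z: "z \<in> A" using dz d2 st by (auto simp: t_def dist_commute subset_iff)
          have Dz: "norm (D (z, v) - D (z0, w0)) \<le> e / 2" if v: "v \<in> ball w0 t" for v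
          proof -
            have "dist (z, v) (z0, w0) \<le> dist z z0 + dist v w0"
              by (simp add: dist_Pair_Pair sqrt_sum_squares_le_sum)
            also have "\<dots> < d1" using dz v st by (simp add: t_def dist_commute)
            finally show ?thesis using d1(2) by (simp add: dist_norm less_imp_le)
          qed
          have tB: "ball w0 t \<subseteq> B" using d3 by (auto simp: t_def)
          have w: "w \<in> ball w0 t" using dw st by (simp add: dist_commute)
          have kz: "k * z \<in> ball w0 t"
          proof -
            have "dist w0 (k * z) = norm k * dist z z0"
              by (simp add: True dist_norm norm_mult[symmetric] algebra_simps norm_minus_commute)
            also have "\<dots> \<le> norm k * s" using dz by (intro mult_left_mono) auto
            finally show ?thesis using ks by simp
          qed
          have "norm (g p - D (z0, w0)) \<le> e / 2"
          proof (cases "w = k * z")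
            case True
            then show ?thesis using Dz[OF w] by (simp add: g_def p_eq)
          next
            case False
            \<comment> \<open>Mean value inequality in the second variable between
              \<open>k * z\<close> and \<open>w\<close>. As \<open>F\<close> vanishes at
              \<open>(z, k * z)\<close>, dividing by \<open>w - k * z\<close> turns this into
              closeness of the quotient to \<open>D (z0, w0)\<close>.\<close>
            have "norm ((F (z, w) - D (z0, w0) * w) - (F (z, k * z) - D (z0, w0) * (k * z)))
                \<le> e / 2 * norm (w - k * z)"
            proof (rule field_differentiable_bound[of "ball w0 t" _ "\<lambda>v. D (z, v) - D (z0, w0)"])
              fix v assume v: "v \<in> ball w0 t"
              have "((\<lambda>v. F (z, v)) has_field_derivative D (z, v)) (at v)"
                using holomorphic_derivI[OF Fw[OF z] B] tB v by (auto simp: D_def)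
              then show "((\<lambda>v. F (z, v) - D (z0, w0) * v) has_field_derivative D (z, v) - D (z0, w0))
                  (at v within ball w0 t)"
                by (auto intro!: derivative_eq_intros intro: has_field_derivative_at_within)
            qed (use Dz w kz in auto)
            moreover have "F (z, k * z) = 0" using zero z kz tB by blast
            ultimately have "norm (F (z, w) - D (z0, w0) * (w - k * z)) \<le> e / 2 * norm (w - k * z)"
              by (simp add: algebra_simps)
            moreover have "F (z, w) - D (z0, w0) * (w - k * z) = (g p - D (z0, w0)) * (w - k * z)"
              using False by (simp add: g_def p_eq field_simps)
            ultimately show ?thesis using False by (simp add: norm_mult)
          qed
          moreover have "g (z0, w0) = D (z0, w0)" using True by (simp add: g_def)
          ultimately show "dist (g p) (g (z0, w0)) < e" using e by (simp add: dist_norm)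
        qed (use s in auto)
      qed
    qed
    then show ?thesis by (auto intro: continuous_at_imp_continuous_on)
  qed
  have holz: "(\<lambda>z. g (z, w)) holomorphic_on A" if w: "w \<in> B" for w
  proof -
    have cont: "continuous_on A (\<lambda>z. g (z, w))"
      by (rule continuous_on_compose2[OF contg]) (use w in \<open>auto intro!: continuous_intros\<close>)
    \<comment> \<open>For fixed \<open>w\<close>, the slice meets the line at most in
      \<open>w / k\<close>, or not at all, or lies entirely on it.\<close>
    consider "k \<noteq> 0" | "k = 0" "w \<noteq> 0" | "k = 0" "w = 0" by blast
    then show ?thesis
    proof cases
      case 1
      have "(\<lambda>z. F (z, w) / (w - k * z)) holomorphic_on (A - {w / k})"
        using 1 by (intro holomorphic_intros holomorphic_on_subset[OF Fz[OF w]]) (auto simp: field_simps)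
      then have "(\<lambda>z. g (z, w)) holomorphic_on (A - {w / k})"
        by (rule holomorphic_transform) (use 1 in \<open>auto simp: g_def field_simps\<close>)
      then show ?thesis using no_isolated_singularity[OF cont _ A] by blast
    next
      case 2
      have "(\<lambda>z. F (z, w) / w) holomorphic_on A"
        using 2 by (intro holomorphic_intros Fz[OF w])
      then show ?thesis by (rule holomorphic_transform) (use 2 in \<open>auto simp: g_def\<close>)
    next
      \<comment> \<open>On this slice \<open>g\<close> is nowhere given as a quotient. By joint
        continuity of \<open>g\<close> it is the locally uniform limit of the holomorphic slices
        \<open>F (x, v) / v\<close> as \<open>v\<close> tends to 0.\<close>
      case 3
      show ?thesis unfolding holomorphic_on_open[OF A]
      proof
        fix z assume z: "z \<in> A"
        obtain r where r: "r > 0" "cball z r \<subseteq> A" using A z open_contains_cball by blast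
        have swapc: "continuous_on (B \<times> cball z r) (\<lambda>p. g (snd p, fst p))"
          by (rule continuous_on_compose2[OF contg]) (use r in \<open>auto intro!: continuous_intros\<close>)
        have nB: "\<forall>\<^sub>F v in at 0. v \<in> B" using B w 3 by (simp add: eventually_at_in_open')
        have ul: "uniform_limit (cball z r) (\<lambda>v x. g (x, v)) (\<lambda>x. g (x, 0)) (at 0)"
        proof (rule uniform_limitI)
          fix e :: real assume e: "e > 0"
          obtain X0 where X0: "0 \<in> X0" "open X0"
            "\<forall>v\<in>X0 \<inter> B. \<forall>t\<in>cball z r. dist (g (t, v)) (g (t, 0)) \<le> e / 2"
            using continuous_on_prod_compactE[OF swapc compact_cball, of 0 "e/2"] w 3 e by auto
          have "\<forall>\<^sub>F v in at 0. v \<in> X0" using X0 by (simp add: eventually_at_in_open')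
          with nB show "\<forall>\<^sub>F v in at 0. \<forall>x\<in>cball z r. dist (g (x, v)) (g (x, 0)) < e"
          proof eventually_elim
            case (elim v)
            then show ?case using X0(3) e by force
          qed
        qed
        have "\<forall>\<^sub>F v in at 0. continuous_on (cball z r) (\<lambda>x. g (x, v)) \<and> (\<lambda>x. g (x, v)) holomorphic_on ball z r"
        proof -
          have "\<forall>\<^sub>F v in at (0::complex). v \<noteq> 0" by (simp add: eventually_at_filter)
          with nB show ?thesis
          proof eventually_elim
            case (elim v)
            have "(\<lambda>z. F (z, v) / v) holomorphic_on A"
              using elim by (intro holomorphic_intros Fz) auto
            then have "(\<lambda>x. g (x, v)) holomorphic_on A"
              by (rule holomorphic_transform) (use 3 elim in \<open>auto simp: g_def\<close>)
            then have "(\<lambda>x. g (x, v)) holomorphic_on cball z r"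
              using r(2) by (rule holomorphic_on_subset)
            then show ?case
              by (meson ball_subset_cball holomorphic_on_imp_continuous_on holomorphic_on_subset)
          qed
        qed
        from holomorphic_uniform_limit[OF this ul] have "(\<lambda>x. g (x, 0)) holomorphic_on ball z r"
          by auto
        then show "\<exists>f'. ((\<lambda>z. g (z, w)) has_field_derivative f') (at z)"
          using r(1) 3 by (auto simp: holomorphic_on_open)
      qed
    qed
  qed
  have "holo2 (A \<times> B) g" by (rule Osgood[OF A B contg holz holw])
  moreover have "F (z, w) = (w - k * z) * g (z, w)" if "z \<in> A" "w \<in> B" for z w
    using that zero by (auto simp: g_def)
  ultimately show ?thesis by (rule that)
qed

lemma holo2_swap: "holo2 (A \<times> B) f \<Longrightarrow> holo2 (B \<times> A) (\<lambda>p. f (snd p, fst p))"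
  by (rule holo2_compose_pair[OF _ holo2_snd holo2_fst]) auto

lemma holo2_divide_line_fst:
  fixes F :: fn2
  assumes A: "open A" and B: "open B" and F: "holo2 (A \<times> B) F"
    and zero: "\<And>w. w \<in> B \<Longrightarrow> k * w \<in> A \<Longrightarrow> F (k * w, w) = 0"
  obtains g where "holo2 (A \<times> B) g" "\<And>z w. z \<in> A \<Longrightarrow> w \<in> B \<Longrightarrow> F (z, w) = (z - k * w) * g (z, w)"
proof -
  obtain g where g: "holo2 (B \<times> A) g"
    "\<And>z w. z \<in> B \<Longrightarrow> w \<in> A \<Longrightarrow> F (w, z) = (w - k * z) * g (z, w)"
    using holo2_divide_line_snd[OF B A holo2_swap[OF F], of k] zero by auto
  show ?thesis
    by (rule that[OF holo2_swap[OF g(1)]]) (use g(2) in auto)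
qed

text \<open>An open subset of the plane has no isolated points, so continuity determines the value
  at \<open>c\<close>. This cancels a factor with one zero without any connectedness of
  \<open>B\<close>.\<close>

lemma continuous_eq_0_at_puncture:
  fixes f :: fn1
  assumes "open B" "continuous_on B f" "\<And>w. w \<in> B \<Longrightarrow> w \<noteq> c \<Longrightarrow> f w = 0" "w \<in> B"
  shows "f w = 0"
proof (cases "w = c")
  case True
  have "isCont f w" using assms by (simp add: continuous_on_eq_continuous_at)
  then have "(f \<longlongrightarrow> f w) (at w)" by (simp add: isCont_def)
  moreover have "\<forall>\<^sub>F x in at w. f x = 0"
  proof -
    have "\<forall>\<^sub>F x in at w. x \<in> B - {w}" using assms by (intro eventually_at_in_open)
    then show ?thesis by eventually_elim (use assms True in auto)
  qed
  then have "(f \<longlongrightarrow> 0) (at w)" by (rule tendsto_eventually)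
  ultimately show ?thesis by (rule tendsto_unique[rotated]) simp
qed (use assms in auto)

lemma mult_line_snd_eq_0:
  fixes f :: fn2
  assumes "open B" "continuous_on (A \<times> B) f"
    and "\<And>z w. z \<in> A \<Longrightarrow> w \<in> B \<Longrightarrow> (w - k * z) * f (z, w) = 0" "z \<in> A" "w \<in> B"
  shows "f (z, w) = 0"
proof (rule continuous_eq_0_at_puncture[OF \<open>open B\<close>, of "\<lambda>w. f (z, w)" "k * z"])
  show "continuous_on B (\<lambda>w. f (z, w))"
    by (rule continuous_on_compose2[OF assms(2)]) (use assms in \<open>auto intro!: continuous_intros\<close>)
qed (use assms in force)+

lemma mult_line_fst_eq_0:
  fixes f :: fn2
  assumes "open A" "continuous_on (A \<times> B) f"
    and "\<And>z w. z \<in> A \<Longrightarrow> w \<in> B \<Longrightarrow> (z - k * w) * f (z, w) = 0" "z \<in> A" "w \<in> B"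
  shows "f (z, w) = 0"
proof (rule continuous_eq_0_at_puncture[OF \<open>open A\<close>, of "\<lambda>z. f (z, w)" "k * w"])
  show "continuous_on A (\<lambda>z. f (z, w))"
    by (rule continuous_on_compose2[OF assms(2)]) (use assms in \<open>auto intro!: continuous_intros\<close>)
qed (use assms in force)+

lemma mult_line_snd_eq_0_fun:
  assumes "holo2 (A \<times> B) f" "open B" "\<And>p. p \<notin> A \<times> B \<Longrightarrow> f p = 0" "\<And>p. (snd p - k * fst p) * f p = 0"
  shows "f = (\<lambda>_. 0)"
proof
  fix p
  have "f (z, w) = 0" if "z \<in> A" "w \<in> B" for z w
    by (rule mult_line_snd_eq_0[OF assms(2) holo2_imp_continuous_on[OF assms(1)] _ that, of k])
       (use assms(4) in force)
  then show "f p = 0" using assms(3)[of p] by (cases "p \<in> A \<times> B") auto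
qed

lemma mult_line_fst_eq_0_fun:
  assumes "holo2 (A \<times> B) f" "open A" "\<And>p. p \<notin> A \<times> B \<Longrightarrow> f p = 0" "\<And>p. (fst p - k * snd p) * f p = 0"
  shows "f = (\<lambda>_. 0)"
proof
  fix p
  have "f (z, w) = 0" if "z \<in> A" "w \<in> B" for z w
    by (rule mult_line_fst_eq_0[OF assms(2) holo2_imp_continuous_on[OF assms(1)] _ that, of k])
       (use assms(4) in force)
  then show "f p = 0" using assms(3)[of p] by (cases "p \<in> A \<times> B") auto
qed

section \<open>Factorisation and splitting of functions on products of open sets\<close>

lemmas holo2_intros = holo2_add holo2_diff holo2_mult holo2_minus holo2_fst holo2_snd holo2_const

lemma holo2_if:
  assumes "holo2 S f" "open S"
  shows "holo2 S (\<lambda>p. if p \<in> S then f p else 0)"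
  by (rule holo2_cong[OF assms]) simp

lemma holo2_fst_axis: "holo2 (A \<times> B) f \<Longrightarrow> c \<in> B \<Longrightarrow> holo2 (A \<times> C) (\<lambda>p. f (fst p, c))"
  by (rule holo2_compose_pair[OF _ holo2_fst holo2_const]) auto

lemma holo2_snd_axis: "holo2 (A \<times> B) f \<Longrightarrow> c \<in> A \<Longrightarrow> holo2 (C \<times> B) (\<lambda>p. f (c, snd p))"
  by (rule holo2_compose_pair[OF _ holo2_const holo2_snd]) auto

lemma holo2_of_fst: "f holomorphic_on A \<Longrightarrow> open A \<Longrightarrow> holo2 (A \<times> B) (\<lambda>p. f (fst p))"
  by (rule holo2_compose_holomorphic[OF holo2_fst]) auto

lemma holo2_of_snd: "f holomorphic_on B \<Longrightarrow> open B \<Longrightarrow> holo2 (A \<times> B) (\<lambda>p. f (snd p))"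
  by (rule holo2_compose_holomorphic[OF holo2_snd]) auto

lemma holo2_slice_fst:
  "holo2 (A \<times> B) f \<Longrightarrow> open A \<Longrightarrow> c \<in> B \<Longrightarrow> (\<lambda>z. f (z, c)) holomorphic_on A"
  by (rule holo2_curve_holomorphic) (auto intro!: holomorphic_intros)

lemma holo2_slice_snd:
  "holo2 (A \<times> B) f \<Longrightarrow> open B \<Longrightarrow> c \<in> A \<Longrightarrow> (\<lambda>w. f (c, w)) holomorphic_on B"
  by (rule holo2_curve_holomorphic) (auto intro!: holomorphic_intros)

text \<open>Extending the quotient by 0 matches the normalisation of \<open>Q_carrier\<close>. The
  factorisation then holds at every point, so later identities between quadruples are plain
  equalities of functions.\<close>

lemma factor_line_snd:
  fixes F :: fn2
  assumes "open A" "open B" "holo2 (A \<times> B) F" "\<And>p. p \<notin> A \<times> B \<Longrightarrow> F p = 0"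
    and "\<And>z. z \<in> A \<Longrightarrow> k * z \<in> B \<Longrightarrow> F (z, k * z) = 0"
  obtains g where "holo2 (A \<times> B) g" "\<And>p. p \<notin> A \<times> B \<Longrightarrow> g p = 0"
    "\<And>p. F p = (snd p - k * fst p) * g p"
proof -
  obtain g where g: "holo2 (A \<times> B) g" "\<And>z w. z \<in> A \<Longrightarrow> w \<in> B \<Longrightarrow> F (z, w) = (w - k * z) * g (z, w)"
    using holo2_divide_line_snd[OF assms(1-3), of k] assms(5) by blast
  show ?thesis
  proof (rule that)
    show "holo2 (A \<times> B) (\<lambda>p. if p \<in> A \<times> B then g p else 0)"
      using g(1) assms(1,2) by (intro holo2_if open_Times)
    show "F p = (snd p - k * fst p) * (if p \<in> A \<times> B then g p else 0)" for p
      using g(2)[of "fst p" "snd p"] assms(4)[of p] by (cases "p \<in> A \<times> B") auto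
  qed simp
qed

lemma factor_line_fst:
  fixes F :: fn2
  assumes "open A" "open B" "holo2 (A \<times> B) F" "\<And>p. p \<notin> A \<times> B \<Longrightarrow> F p = 0"
    and "\<And>w. w \<in> B \<Longrightarrow> k * w \<in> A \<Longrightarrow> F (k * w, w) = 0"
  obtains g where "holo2 (A \<times> B) g" "\<And>p. p \<notin> A \<times> B \<Longrightarrow> g p = 0"
    "\<And>p. F p = (fst p - k * snd p) * g p"
proof -
  obtain g where g: "holo2 (A \<times> B) g" "\<And>z w. z \<in> A \<Longrightarrow> w \<in> B \<Longrightarrow> F (z, w) = (z - k * w) * g (z, w)"
    using holo2_divide_line_fst[OF assms(1-3), of k] assms(5) by blast
  show ?thesis
  proof (rule that)
    show "holo2 (A \<times> B) (\<lambda>p. if p \<in> A \<times> B then g p else 0)"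
      using g(1) assms(1,2) by (intro holo2_if open_Times)
    show "F p = (fst p - k * snd p) * (if p \<in> A \<times> B then g p else 0)" for p
      using g(2)[of "fst p" "snd p"] assms(4)[of p] by (cases "p \<in> A \<times> B") auto
  qed simp
qed

text \<open>Since \<open>F (0, 0) = 0\<close>, subtracting both restrictions leaves a function
  vanishing on both axes, which can be divided by \<open>w\<close> and then by \<open>z\<close>. It
  serves the mixed components, where the image of \<open>dd1\<close> consists of multiples of one
  coordinate plus multiples of the other.\<close>

lemma split_along_axes:
  fixes F :: fn2
  assumes A: "open A" "0 \<in> A" and B: "open B" "0 \<in> B" and F: "holo2 (A \<times> B) F" "F (0, 0) = 0"
  obtains g where "holo2 (A \<times> B) g"
    "\<And>z w. z \<in> A \<Longrightarrow> w \<in> B \<Longrightarrow> F (z, w) = F (z, 0) + F (0, w) + z * w * g (z, w)"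
proof -
  define G where "G p = F p - F (fst p, 0) - F (0, snd p)" for p
  have G: "holo2 (A \<times> B) G" unfolding G_def
    by (intro holo2_intros F holo2_fst_axis[OF F(1)] holo2_snd_axis[OF F(1)] A B)
  obtain h where h: "holo2 (A \<times> B) h" "\<And>z w. z \<in> A \<Longrightarrow> w \<in> B \<Longrightarrow> G (z, w) = (w - 0 * z) * h (z, w)"
    using holo2_divide_line_snd[OF A(1) B(1) G, of 0] F(2) by (auto simp: G_def)
  \<comment> \<open>After the first division only \<open>w * h (0, w) = 0\<close> is known;
    \<open>w\<close> is cancelled on the single slice over 0 so that the second division
    applies.\<close>
  have "h (0, w) = 0" if w: "w \<in> B" for w
  proof (rule mult_line_snd_eq_0[of B "{0}" h 0])
    show "continuous_on ({0} \<times> B) h"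
      using holo2_imp_continuous_on[OF h(1)] by (rule continuous_on_subset) (use A in auto)
    show "(w - 0 * z) * h (z, w) = 0" if "z \<in> {0}" "w \<in> B" for z w
      using h(2)[of 0 w] that A F(2) by (simp add: G_def)
  qed (use B w in auto)
  then obtain g where g: "holo2 (A \<times> B) g" "\<And>z w. z \<in> A \<Longrightarrow> w \<in> B \<Longrightarrow> h (z, w) = (z - 0 * w) * g (z, w)"
    using holo2_divide_line_fst[OF A(1) B(1) h(1), of 0] by auto
  show ?thesis
  proof (rule that[OF g(1)])
    fix z w assume zw: "z \<in> A" "w \<in> B"
    have "F (z, w) - F (z, 0) - F (0, w) = z * w * g (z, w)"
      using h(2)[OF zw] g(2)[OF zw] by (simp add: G_def)
    then show "F (z, w) = F (z, 0) + F (0, w) + z * w * g (z, w)" by (simp add: algebra_simps)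
  qed
qed

text \<open>The total derivative at the origin is linear, and its two coefficients are read off from
  the axes, where the product rule gives \<open>g 0\<close> and \<open>h 0\<close>. It computes the
  value at 0 of a restriction to a line divided by the coordinate, using only the gluing data on the
  axes.\<close>

lemma deriv_along_line:
  fixes f :: fn2
  assumes A: "open A" "0 \<in> A" and B: "open B" "0 \<in> B" and f: "holo2 (A \<times> B) f"
    and g: "g holomorphic_on A" "\<And>z. z \<in> A \<Longrightarrow> f (z, 0) = z * g z"
    and h: "h holomorphic_on B" "\<And>w. w \<in> B \<Longrightarrow> f (0, w) = w * h w"
  shows "deriv (\<lambda>z. f (c * z, e * z)) 0 = c * g 0 + e * h 0"
proof -
  have "(0, 0) \<in> A \<times> B" using A B by simp
  then obtain a b where ab: "(f has_derivative (\<lambda>h. a * fst h + b * snd h)) (at (0, 0))"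
    using f unfolding holo2_def by blast
  have line: "((\<lambda>z. f (c * z, e * z)) has_field_derivative (a * c + b * e)) (at 0)" for c e
    using ab by (intro holo2_curve_derivative) (auto intro!: derivative_eq_intros)
  have "(g has_field_derivative deriv g 0) (at 0)" using g A by (simp add: holomorphic_derivI)
  then have "((\<lambda>z. z * g z) has_field_derivative g 0) (at 0)" by (auto intro!: derivative_eq_intros)
  then have "((\<lambda>z. f (z, 0)) has_field_derivative g 0) (at 0)"
    by (rule has_field_derivative_transform_within_open[OF _ A]) (simp add: g(2))
  then have a: "a = g 0" using line[of 1 0] by (simp add: DERIV_unique)
  have "(h has_field_derivative deriv h 0) (at 0)" using h B by (simp add: holomorphic_derivI)
  then have "((\<lambda>z. z * h z) has_field_derivative h 0) (at 0)" by (auto intro!: derivative_eq_intros)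
  then have "((\<lambda>z. f (0, z)) has_field_derivative h 0) (at 0)"
    by (rule has_field_derivative_transform_within_open[OF _ B]) (simp add: h(2))
  then have b: "b = h 0" using line[of 0 1] by (simp add: DERIV_unique)
  show ?thesis unfolding DERIV_imp_deriv[OF line] a b by (simp add: algebra_simps)
qed

section \<open>Locally uniform convergence\<close>

text \<open>For intersections, the union of the two compact sets and the smaller radius
  work.\<close>

lemma istopology_lcu:
  "istopology (\<lambda>S :: ('a \<Rightarrow> complex) set. \<forall>f\<in>S. \<exists>K e. compact K \<and> K \<subseteq> D \<and> e > 0 \<and>
      (\<forall>g. (\<forall>x\<in>K. dist (g x) (f x) \<le> e) \<longrightarrow> g \<in> S))"
  for D :: "'a::metric_space set"
proof -
  define P where "P S f K e \<longleftrightarrow> compact K \<and> K \<subseteq> D \<and> e > 0 \<and>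
      (\<forall>g. (\<forall>x\<in>K. dist (g x) (f x) \<le> e) \<longrightarrow> g \<in> S)"
    for S :: "('a \<Rightarrow> complex) set" and f K and e :: real
  have Int: "P (S \<inter> T) f (K1 \<union> K2) (min e1 e2)" if "P S f K1 e1" "P T f K2 e2" for S T f K1 K2 e1 e2
    using that unfolding P_def by (auto simp: ball_Un)
  have mono: "P T f K e" if "P S f K e" "S \<subseteq> T" for S T f K e
    using that unfolding P_def by blast
  have "istopology (\<lambda>S. \<forall>f\<in>S. \<exists>K e. P S f K e)"
    unfolding istopology_def
  proof (intro conjI allI impI ballI)
    fix S T f
    assume S: "\<forall>f\<in>S. \<exists>K e. P S f K e" and T: "\<forall>f\<in>T. \<exists>K e. P T f K e" and f: "f \<in> S \<inter> T"
    obtain K1 e1 where 1: "P S f K1 e1" using bspec[OF S IntD1[OF f]] by (elim exE)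
    obtain K2 e2 where 2: "P T f K2 e2" using bspec[OF T IntD2[OF f]] by (elim exE)
    show "\<exists>K e. P (S \<inter> T) f K e" by (intro exI) (rule Int[OF 1 2])
  next
    fix \<K> f assume K: "\<forall>S\<in>\<K>. \<forall>f\<in>S. \<exists>K e. P S f K e" "f \<in> \<Union>\<K>"
    then obtain S where S: "S \<in> \<K>" "f \<in> S" by (elim UnionE)
    obtain K e where "P S f K e" using bspec[OF bspec[OF K(1) S(1)] S(2)] by (elim exE)
    then have "P (\<Union>\<K>) f K e" by (rule mono) (rule Union_upper[OF S(1)])
    then show "\<exists>K e. P (\<Union>\<K>) f K e" by (intro exI)
  qed
  then show ?thesis unfolding P_def .
qed

lemma openin_lcu:
  "openin (lcu_topology D) S \<longleftrightarrow> (\<forall>f\<in>S. \<exists>K e. compact K \<and> K \<subseteq> D \<and> e > 0 \<and>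
      (\<forall>g. (\<forall>x\<in>K. dist (g x) (f x) \<le> e) \<longrightarrow> g \<in> S))"
  unfolding lcu_topology_def topology_inverse'[OF istopology_lcu] ..

lemma topspace_lcu [simp]: "topspace (lcu_topology D) = UNIV"
proof -
  have "openin (lcu_topology D) UNIV" unfolding openin_lcu
    by (intro ballI exI[of _ "{}"] exI[of _ 1]) simp
  then show ?thesis using openin_subset by blast
qed

text \<open>Continuity becomes an estimate uniform on each compact set, the form in which it is
  verified for all maps of the complex.\<close>

lemma continuous_map_lcu:
  "continuous_map X (lcu_topology D) F \<longleftrightarrow>
     (\<forall>x\<in>topspace X. \<forall>K e. compact K \<longrightarrow> K \<subseteq> D \<longrightarrow> e > 0 \<longrightarrow>
        (\<exists>U. openin X U \<and> x \<in> U \<and> (\<forall>y\<in>U. \<forall>p\<in>K. dist (F y p) (F x p) \<le> e)))"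
  (is "_ \<longleftrightarrow> ?R")
proof
  assume cont: "continuous_map X (lcu_topology D) F"
  show ?R
  proof (intro ballI allI impI)
    fix x K and e :: real
    assume x: "x \<in> topspace X" and K: "compact K" "K \<subseteq> D" and e: "e > 0"
    \<comment> \<open>The functions are arbitrary, so a pointwise bound \<open>< e\<close> on
      \<open>K\<close> would leave no uniform margin. The smaller \<open>e'\<close> supplies one and
      makes \<open>T\<close> open.\<close>
    define T where "T = {g. \<exists>e'<e. \<forall>p\<in>K. dist (g p) (F x p) \<le> e'}"
    have "openin (lcu_topology D) T" unfolding openin_lcu
    proof
      fix f assume "f \<in> T"
      then obtain e' where e': "e' < e" "\<And>p. p \<in> K \<Longrightarrow> dist (f p) (F x p) \<le> e'" by (auto simp: T_def)
      show "\<exists>K e. compact K \<and> K \<subseteq> D \<and> 0 < e \<and> (\<forall>g. (\<forall>x\<in>K. dist (g x) (f x) \<le> e) \<longrightarrow> g \<in> T)"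
      proof (intro exI[of _ K] exI[of _ "(e - e') / 2"] conjI allI impI)
        fix g assume g: "\<forall>p\<in>K. dist (g p) (f p) \<le> (e - e') / 2"
        have "dist (g p) (F x p) \<le> (e + e') / 2" if "p \<in> K" for p
          using dist_triangle[of "g p" "F x p" "f p"] bspec[OF g that] e'(2)[OF that]
          by (simp add: field_simps)
        moreover have "(e + e') / 2 < e" using e'(1) by simp
        ultimately show "g \<in> T" unfolding T_def by blast
      qed (use K e' in auto)
    qed
    then have "openin X {y \<in> topspace X. F y \<in> T}"
      using cont by (rule openin_continuous_map_preimage[rotated])
    moreover have "F x \<in> T" using e by (auto simp: T_def)
    ultimately show "\<exists>U. openin X U \<and> x \<in> U \<and> (\<forall>y\<in>U. \<forall>p\<in>K. dist (F y p) (F x p) \<le> e)"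
      using x by (intro exI[of _ "{y \<in> topspace X. F y \<in> T}"]) (auto simp: T_def intro: order_trans less_imp_le)
  qed
next
  assume R: ?R
  show "continuous_map X (lcu_topology D) F"
    unfolding continuous_map_def
  proof (intro conjI allI impI)
    fix S assume S: "openin (lcu_topology D) S"
    show "openin X {x \<in> topspace X. F x \<in> S}"
    proof (subst openin_subopen, intro ballI)
      fix x assume "x \<in> {x \<in> topspace X. F x \<in> S}"
      then have x: "x \<in> topspace X" "F x \<in> S" by auto
      then obtain K e where K: "compact K" "K \<subseteq> D" "e > 0"
        "\<And>g. (\<forall>p\<in>K. dist (g p) (F x p) \<le> e) \<Longrightarrow> g \<in> S" using S unfolding openin_lcu by meson
      then obtain U where "openin X U" "x \<in> U" "\<forall>y\<in>U. \<forall>p\<in>K. dist (F y p) (F x p) \<le> e"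
        using R x by meson
      then show "\<exists>T. openin X T \<and> x \<in> T \<and> T \<subseteq> {x \<in> topspace X. F x \<in> S}"
        using K(4) openin_subset by (intro exI[of _ U]) blast
    qed
  qed auto
qed

lemma continuous_map_lcuD:
  assumes "continuous_map X (lcu_topology D) F" "x \<in> topspace X" "compact K" "K \<subseteq> D" "e > 0"
  obtains U where "openin X U" "x \<in> U" "\<And>y p. y \<in> U \<Longrightarrow> p \<in> K \<Longrightarrow> dist (F y p) (F x p) \<le> e"
  using assms unfolding continuous_map_lcu by meson

text \<open>Only compact subsets of \<open>D\<close> enter the topology, so extension by 0 outside
  \<open>D\<close> does not affect continuity.\<close>

lemma continuous_map_lcu_cong:
  assumes "continuous_map X (lcu_topology D) F"
    and "\<And>x p. x \<in> topspace X \<Longrightarrow> p \<in> D \<Longrightarrow> G x p = F x p"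
  shows "continuous_map X (lcu_topology D) G"
  unfolding continuous_map_lcu
proof (intro ballI allI impI)
  fix x K and e :: real assume *: "x \<in> topspace X" "compact K" "K \<subseteq> D" "e > 0"
  obtain U where "openin X U" "x \<in> U" "\<And>y p. y \<in> U \<Longrightarrow> p \<in> K \<Longrightarrow> dist (F y p) (F x p) \<le> e"
    by (rule continuous_map_lcuD[OF assms(1) *]) (rule that)
  moreover have "dist (G y p) (G x p) = dist (F y p) (F x p)" if "y \<in> U" "p \<in> K" for y p
    using that * assms(2) openin_subset[OF \<open>openin X U\<close>] by (simp add: subset_iff)
  ultimately show "\<exists>U. openin X U \<and> x \<in> U \<and> (\<forall>y\<in>U. \<forall>p\<in>K. dist (G y p) (G x p) \<le> e)"
    by (intro exI[of _ U]) simp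
qed

lemma continuous_map_lcu_const: "continuous_map X (lcu_topology D) (\<lambda>x p. c p)"
  unfolding continuous_map_lcu using openin_topspace by force

lemma continuous_map_lcu_add:
  assumes "continuous_map X (lcu_topology D) F" "continuous_map X (lcu_topology D) G"
  shows "continuous_map X (lcu_topology D) (\<lambda>x p. F x p + G x p)"
  unfolding continuous_map_lcu
proof (intro ballI allI impI)
  fix x K and e :: real assume *: "x \<in> topspace X" "compact K" "K \<subseteq> D" "e > 0"
  then have e2: "e / 2 > 0" by simp
  obtain U where U: "openin X U" "x \<in> U" "\<And>y p. y \<in> U \<Longrightarrow> p \<in> K \<Longrightarrow> dist (F y p) (F x p) \<le> e/2"
    by (rule continuous_map_lcuD[OF assms(1) *(1-3) e2]) (rule that)
  obtain V where V: "openin X V" "x \<in> V" "\<And>y p. y \<in> V \<Longrightarrow> p \<in> K \<Longrightarrow> dist (G y p) (G x p) \<le> e/2"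
    by (rule continuous_map_lcuD[OF assms(2) *(1-3) e2]) (rule that)
  show "\<exists>U. openin X U \<and> x \<in> U \<and> (\<forall>y\<in>U. \<forall>p\<in>K. dist (F y p + G y p) (F x p + G x p) \<le> e)"
  proof (intro exI[of _ "U \<inter> V"] conjI ballI)
    fix y p assume "y \<in> U \<inter> V" "p \<in> K"
    then show "dist (F y p + G y p) (F x p + G x p) \<le> e"
      using U(3)[of y p] V(3)[of y p] dist_triangle_add[of "F y p" "G y p" "F x p" "G x p"] by simp
  qed (use U V in auto)
qed

lemma continuous_map_lcu_mult:
  assumes "continuous_map X (lcu_topology D) F" "continuous_on D m"
  shows "continuous_map X (lcu_topology D) (\<lambda>x p. m p * F x p)"
  unfolding continuous_map_lcu
proof (intro ballI allI impI)
  fix x K and e :: real assume *: "x \<in> topspace X" "compact K" "K \<subseteq> D" "e > 0"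
  have "compact (m ` K)"
    by (rule compact_continuous_image[OF continuous_on_subset[OF assms(2) *(3)] *(2)])
  then have "bounded (m ` K)" by (rule compact_imp_bounded)
  then obtain B where B: "B > 0" "\<And>p. p \<in> K \<Longrightarrow> norm (m p) \<le> B"
    unfolding bounded_pos by blast
  then have e2: "e / B > 0" using * by simp
  obtain U where U: "openin X U" "x \<in> U" "\<And>y p. y \<in> U \<Longrightarrow> p \<in> K \<Longrightarrow> dist (F y p) (F x p) \<le> e/B"
    by (rule continuous_map_lcuD[OF assms(1) *(1-3) e2]) (rule that)
  show "\<exists>U. openin X U \<and> x \<in> U \<and> (\<forall>y\<in>U. \<forall>p\<in>K. dist (m p * F y p) (m p * F x p) \<le> e)"
  proof (intro exI[of _ U] conjI ballI)
    fix y p assume yp: "y \<in> U" "p \<in> K"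
    have "dist (m p * F y p) (m p * F x p) = norm (m p) * dist (F y p) (F x p)"
      by (simp add: dist_norm norm_mult flip: right_diff_distrib)
    also have "\<dots> \<le> B * (e / B)" using B U(3)[OF yp] yp by (intro mult_mono) auto
    finally show "dist (m p * F y p) (m p * F x p) \<le> e" using B by simp
  qed (use U in auto)
qed

lemma continuous_map_lcu_reindex:
  assumes "continuous_map X (lcu_topology D') F" "continuous_on D h" "h ` D \<subseteq> D'"
  shows "continuous_map X (lcu_topology D) (\<lambda>x p. F x (h p))"
  unfolding continuous_map_lcu
proof (intro ballI allI impI)
  fix x K and e :: real assume *: "x \<in> topspace X" "compact K" "K \<subseteq> D" "e > 0"
  have hK: "compact (h ` K)"
    by (rule compact_continuous_image[OF continuous_on_subset[OF assms(2) *(3)] *(2)])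
  have hK': "h ` K \<subseteq> D'" using assms(3) *(3) by blast
  obtain U where "openin X U" "x \<in> U" "\<And>y p. y \<in> U \<Longrightarrow> p \<in> h ` K \<Longrightarrow> dist (F y p) (F x p) \<le> e"
    by (rule continuous_map_lcuD[OF assms(1) *(1) hK hK' *(4)]) (rule that)
  then show "\<exists>U. openin X U \<and> x \<in> U \<and> (\<forall>y\<in>U. \<forall>p\<in>K. dist (F y (h p)) (F x (h p)) \<le> e)"
    by blast
qed

lemma continuous_map_lcu_minus:
  "continuous_map X (lcu_topology D) F \<Longrightarrow> continuous_map X (lcu_topology D) (\<lambda>x p. - F x p)"
  using continuous_map_lcu_mult[of X D F "\<lambda>_. -1"] by simp

lemma continuous_map_lcu_diff:
  "continuous_map X (lcu_topology D) F \<Longrightarrow> continuous_map X (lcu_topology D) G \<Longrightarrow>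
    continuous_map X (lcu_topology D) (\<lambda>x p. F x p - G x p)"
  using continuous_map_lcu_add[OF _ continuous_map_lcu_minus] by fastforce

section \<open>Division by the coordinate in one variable\<close>

definition div0 :: "fn1 \<Rightarrow> fn1" where
  "div0 f z = (if z = 0 then deriv f 0 else f z / z)"

lemma div0_holomorphic:
  assumes "f holomorphic_on V" "open V" "f 0 = 0"
  shows "div0 f holomorphic_on V"
proof -
  have "div0 f = (\<lambda>z. if z = 0 then deriv f 0 else (f z - f 0) / (z - 0))"
    unfolding div0_def[abs_def] assms(3) diff_zero ..
  then show ?thesis using pole_lemma_open[OF assms(1,2), of 0] by metis
qed

lemma div0_eqI:
  assumes "open V" "0 \<in> V" "g holomorphic_on V" "\<And>z. z \<in> V \<Longrightarrow> f z = z * g z" "z \<in> V"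
  shows "div0 f z = g z"
proof -
  have "(g has_field_derivative deriv g 0) (at 0)"
    using assms by (simp add: holomorphic_derivI)
  then have "((\<lambda>z. z * g z) has_field_derivative g 0) (at 0)"
    by (auto intro!: derivative_eq_intros)
  then have "(f has_field_derivative g 0) (at 0)"
    by (rule has_field_derivative_transform_within_open[of _ _ _ V]) (use assms in auto)
  then show ?thesis using assms by (auto simp: div0_def DERIV_imp_deriv)
qed

lemma div0_lincomb:
  assumes "f holomorphic_on V" "g holomorphic_on V" "open V" "0 \<in> V"
  shows "div0 (\<lambda>z. c * f z + g z) z = c * div0 f z + div0 g z"
proof -
  have "((\<lambda>z. c * f z + g z) has_field_derivative c * deriv f 0 + deriv g 0) (at 0)"
    using assms by (auto intro!: derivative_eq_intros holomorphic_derivI)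
  then show ?thesis by (auto simp: div0_def add_divide_distrib DERIV_imp_deriv)
qed

text \<open>On a small disc around 0 the maximum modulus principle bounds \<open>div0 f\<close> by its values on the
  boundary circle; elsewhere division by \<open>z\<close> is harmless.\<close>

lemma div0_bound:
  assumes "open V" "0 \<in> V" "compact K" "K \<subseteq> V"
  obtains K' C where "compact K'" "K' \<subseteq> V" "C > 0"
    "\<And>f B z. f holomorphic_on V \<Longrightarrow> f 0 = 0 \<Longrightarrow> (\<And>z. z \<in> K' \<Longrightarrow> norm (f z) \<le> B) \<Longrightarrow> z \<in> K \<Longrightarrow>
       norm (div0 f z) \<le> C * B"
proof -
  obtain r where r: "r > 0" "cball 0 r \<subseteq> V" using assms open_contains_cball by blast
  have "norm (div0 f z) \<le> (1 / r) * B"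
    if hol: "f holomorphic_on V" and f0: "f 0 = 0"
      and B: "\<And>z. z \<in> K \<union> cball 0 r \<Longrightarrow> norm (f z) \<le> B" and z: "z \<in> K" for f B z
  proof -
    have big: "norm (div0 f u) \<le> (1 / r) * B" if u: "u \<in> K \<union> cball 0 r" "norm u \<ge> r" for u
    proof -
      have "B \<ge> 0" using B[OF u(1)] norm_ge_zero order_trans by blast
      have "norm (div0 f u) = norm (f u) / norm u"
        using u r by (auto simp: div0_def norm_divide)
      also have "\<dots> \<le> B / r" using B[OF u(1)] u(2) r \<open>B \<ge> 0\<close> by (intro frac_le) auto
      finally show ?thesis by simp
    qed
    show ?thesis
    proof (cases "norm z < r")
      case True
      have h: "div0 f holomorphic_on cball 0 r"
        using div0_holomorphic[OF hol assms(1) f0] r(2) by (rule holomorphic_on_subset)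
      show ?thesis
      proof (rule maximum_modulus_frontier[of "div0 f" "cball 0 r"])
        show "div0 f holomorphic_on interior (cball 0 r)"
          using h by (rule holomorphic_on_subset) (rule interior_subset)
        show "continuous_on (closure (cball 0 r)) (div0 f)"
          using h by (simp add: holomorphic_on_imp_continuous_on)
      qed (use True r big in auto)
    next
      case False
      then show ?thesis using big z by simp
    qed
  qed
  \<comment> \<open>The disc is adjoined to \<open>K\<close> because its boundary circle, which
    controls \<open>div0 f\<close> near 0, need not lie in \<open>K\<close>.\<close>
  then show ?thesis using r assms by (intro that[of "K \<union> cball 0 r" "1 / r"]) auto
qed

text \<open>\<open>div0\<close> is linear on holomorphic functions, and the set \<open>K'\<close>
  and constant \<open>C\<close> of \<open>div0_bound\<close> do not depend on the function. So the
  bound applies to the difference \<open>F y - F x\<close>.\<close>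

lemma continuous_map_lcu_div0:
  assumes V: "open V" "0 \<in> V" and cont: "continuous_map X (lcu_topology V) F"
    and F: "\<And>x. x \<in> topspace X \<Longrightarrow> F x holomorphic_on V" "\<And>x. x \<in> topspace X \<Longrightarrow> F x 0 = 0"
  shows "continuous_map X (lcu_topology V) (\<lambda>x. div0 (F x))"
  unfolding continuous_map_lcu
proof (intro ballI allI impI)
  fix x K and e :: real assume *: "x \<in> topspace X" "compact K" "K \<subseteq> V" "e > 0"
  obtain K' C where K': "compact K'" "K' \<subseteq> V" "C > 0"
    and bd: "\<And>f B z. f holomorphic_on V \<Longrightarrow> f 0 = 0 \<Longrightarrow> (\<And>z. z \<in> K' \<Longrightarrow> norm (f z) \<le> B) \<Longrightarrow> z \<in> K \<Longrightarrow>
       norm (div0 f z) \<le> C * B"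
    using div0_bound[OF V *(2,3)] by blast
  have eC: "e / C > 0" using * K' by simp
  obtain U where U: "openin X U" "x \<in> U" "\<And>y p. y \<in> U \<Longrightarrow> p \<in> K' \<Longrightarrow> dist (F y p) (F x p) \<le> e/C"
    by (rule continuous_map_lcuD[OF cont *(1) K'(1,2) eC]) (rule that)
  show "\<exists>U. openin X U \<and> x \<in> U \<and> (\<forall>y\<in>U. \<forall>p\<in>K. dist (div0 (F y) p) (div0 (F x) p) \<le> e)"
  proof (intro exI[of _ U] conjI ballI)
    fix y p assume yp: "y \<in> U" "p \<in> K"
    have y: "y \<in> topspace X" using U(1) yp openin_subset by blast
    have "norm (div0 (\<lambda>z. (-1) * F x z + F y z) p) \<le> C * (e / C)"
    proof (rule bd)
      show "(\<lambda>z. (-1) * F x z + F y z) holomorphic_on V"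
        using F *(1) y by (intro holomorphic_intros) auto
      show "norm (- 1 * F x z + F y z) \<le> e / C" if "z \<in> K'" for z
        using U(3)[OF yp(1) that] by (simp add: dist_norm)
    qed (use F * y yp in auto)
    also have "div0 (\<lambda>z. (-1) * F x z + F y z) p = (-1) * div0 (F x) p + div0 (F y) p"
      using F *(1) y V by (intro div0_lincomb) auto
    finally show "dist (div0 (F y) p) (div0 (F x) p) \<le> e" using K' by (simp add: dist_norm)
  qed (use U in auto)
qed

section \<open>The complex\<close>

lemma topspace_Q_top [simp]: "topspace (Q_top Ux Uy) = Q_carrier Ux Uy"
  by (simp add: Q_top_def)

lemma topspace_QQ_top [simp]: "topspace (QQ_top Ux Uy) = Q_carrier Ux Uy \<times> Q_carrier Ux Uy"
  by (simp add: QQ_top_def)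

lemma topspace_O_top [simp]: "topspace (O_top Ux Uy) = O_carrier Ux Uy"
  by (simp add: O_top_def)

lemma continuous_map_into_Q_top:
  assumes "\<And>x. x \<in> topspace X \<Longrightarrow> ((A x, B x), (C x, E x)) \<in> Q_carrier Ux Uy"
    and "continuous_map X (lcu_topology (Ux \<times> Ux)) A" "continuous_map X (lcu_topology (Ux \<times> Uy)) B"
    and "continuous_map X (lcu_topology (Uy \<times> Ux)) C" "continuous_map X (lcu_topology (Uy \<times> Uy)) E"
  shows "continuous_map X (Q_top Ux Uy) (\<lambda>x. ((A x, B x), (C x, E x)))"
  unfolding Q_top_def using assms
  by (intro continuous_map_into_subtopology continuous_map_pairedI) auto

lemma continuous_map_into_O_top:
  assumes "\<And>x. x \<in> topspace X \<Longrightarrow> (A x, B x) \<in> O_carrier Ux Uy"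
    and "continuous_map X (lcu_topology Ux) A" "continuous_map X (lcu_topology Uy) B"
  shows "continuous_map X (O_top Ux Uy) (\<lambda>x. (A x, B x))"
  unfolding O_top_def using assms
  by (intro continuous_map_into_subtopology continuous_map_pairedI) auto

lemma continuous_map_Q_top_proj:
  assumes "continuous_map X (Q_top Ux Uy) F"
  shows "continuous_map X (lcu_topology (Ux \<times> Ux)) (\<lambda>x. fst (fst (F x)))"
    "continuous_map X (lcu_topology (Ux \<times> Uy)) (\<lambda>x. snd (fst (F x)))"
    "continuous_map X (lcu_topology (Uy \<times> Ux)) (\<lambda>x. fst (snd (F x)))"
    "continuous_map X (lcu_topology (Uy \<times> Uy)) (\<lambda>x. snd (snd (F x)))"
  using assms unfolding Q_top_def continuous_map_in_subtopology continuous_map_pairwise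
  by (auto simp: o_def)

lemma continuous_map_O_top_proj:
  "continuous_map (O_top Ux Uy) (lcu_topology Ux) fst"
  "continuous_map (O_top Ux Uy) (lcu_topology Uy) snd"
  unfolding O_top_def
  by (auto intro: continuous_map_from_subtopology continuous_map_fst continuous_map_snd)

lemma Q_carrier_iff:
  "((z1, z2), (z3, z4)) \<in> Q_carrier Ux Uy \<longleftrightarrow>
      holo2 (Ux \<times> Ux) z1 \<and> holo2 (Ux \<times> Uy) z2 \<and> holo2 (Uy \<times> Ux) z3 \<and> holo2 (Uy \<times> Uy) z4 \<and>
      (\<forall>p. p \<notin> Ux \<times> Ux \<longrightarrow> z1 p = 0) \<and> (\<forall>p. p \<notin> Ux \<times> Uy \<longrightarrow> z2 p = 0) \<and>
      (\<forall>p. p \<notin> Uy \<times> Ux \<longrightarrow> z3 p = 0) \<and> (\<forall>p. p \<notin> Uy \<times> Uy \<longrightarrow> z4 p = 0) \<and>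
      (\<forall>a\<in>Ux. z1 (a, 0) = z2 (a, 0)) \<and> (\<forall>a\<in>Uy. z3 (a, 0) = z4 (a, 0)) \<and>
      (\<forall>a\<in>Ux. z1 (0, a) = z3 (0, a)) \<and> (\<forall>a\<in>Uy. z2 (0, a) = z4 (0, a))"
  by (simp add: Q_carrier_def)

lemma dd0_eq:
  "dd0 q d l x =
    (((\<lambda>p. 0, \<lambda>p. - (q ^ (l + 1)) * (snd p * snd (fst x) p)),
      (\<lambda>p. fst p * fst (snd x) p, \<lambda>p. (fst p - q ^ (l + 1) * snd p) * snd (snd x) p)),
     ((\<lambda>p. (snd p - q ^ (d + 1) * fst p) * fst (fst x) p, \<lambda>p. - (q ^ (d + 1)) * (fst p * snd (fst x) p)),
      (\<lambda>p. snd p * fst (snd x) p, \<lambda>p. 0)))"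
  by (simp add: dd0_def qadd_def qscale_def opw1_def opw2_def opz1_def opz2_def case_prod_unfold
      algebra_simps)

lemma dd1_eq:
  "dd1 q d l x =
    ((\<lambda>p. (snd p - q ^ d * fst p) * fst (fst (fst x)) p,
      \<lambda>p. q ^ l * (snd p * snd (fst (snd x)) p) - q ^ d * (fst p * snd (fst (fst x)) p)),
     (\<lambda>p. snd p * fst (snd (fst x)) p - fst p * fst (snd (snd x)) p,
      \<lambda>p. (q ^ l * snd p - fst p) * snd (snd (snd x)) p))"
  by (simp add: dd1_def qadd_def qscale_def opw1_def opw2_def opz1_def opz2_def case_prod_unfold
      algebra_simps)

text \<open>The products \<open>z1 w1\<close> and \<open>z2 w2\<close> are zero on quadruples. The
  surviving terms cancel: \<open>z2 w1\<close> occurs with both signs, and the two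
  \<open>z1 w2\<close> terms carry \<open>q ^ d * q ^ (l + 1)\<close> and
  \<open>q ^ l * q ^ (d + 1)\<close>.\<close>

lemma dd1_dd0: "dd1 q d l (dd0 q d l x) = qzero"
  by (simp add: dd0_eq dd1_eq qzero_def algebra_simps)

lemma quad_cases: obtains x1 x2 x3 x4 where "x = ((x1, x2), (x3, x4))"
  by (metis surj_pair)

locale q_open_cross =
  fixes q :: complex and Ux Uy :: "complex set" and d l :: nat
  assumes q: "0 < norm q" "norm q < 1" and q_open: "q_open q Ux" "q_open q Uy"
begin

abbreviation "\<Q> \<equiv> Q_carrier Ux Uy"

definition "K1 = {p \<in> \<Q> \<times> \<Q>. dd1 q d l p = qzero}"

lemma q_nz [simp]: "q \<noteq> 0"
  using q by auto

lemma open_U: "open Ux" "open Uy"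
  and zero_U [simp]: "0 \<in> Ux" "0 \<in> Uy"
  using q_open by (auto simp: q_open_def)

lemma open_UU: "open (Ux \<times> Ux)" "open (Ux \<times> Uy)" "open (Uy \<times> Ux)" "open (Uy \<times> Uy)"
  by (intro open_Times open_U)+

lemma q_mult_U: "z \<in> Ux \<Longrightarrow> q * z \<in> Ux" "z \<in> Uy \<Longrightarrow> q * z \<in> Uy"
  using q_open by (auto simp: q_open_def)

text \<open>Invariance under \<open>q\<close> enters here: the lines \<open>z2 = q ^ n * z1\<close>
  and \<open>w1 = q ^ n * w2\<close> stay in the domain over all of \<open>Ux\<close> and
  \<open>Uy\<close>.\<close>

lemma q_power_U [simp]: "z \<in> Ux \<Longrightarrow> q ^ n * z \<in> Ux" "z \<in> Uy \<Longrightarrow> q ^ n * z \<in> Uy"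
  by (induction n) (auto simp: mult.assoc q_mult_U)

text \<open>The same fact in the form to which simp rewrites \<open>q ^ (n + 1) * z\<close>.\<close>

lemma q_Suc_power_U [simp]: "z \<in> Ux \<Longrightarrow> q * q ^ n * z \<in> Ux" "z \<in> Uy \<Longrightarrow> q * q ^ n * z \<in> Uy"
  by (simp_all add: mult.assoc q_mult_U)

section \<open>The three maps are well defined and continuous\<close>

lemma dd0_in: "x \<in> \<Q> \<Longrightarrow> dd0 q d l x \<in> \<Q> \<times> \<Q>"
  by (cases x rule: quad_cases) (simp add: dd0_eq Q_carrier_iff holo2_intros)

lemma dd1_in: "x \<in> \<Q> \<Longrightarrow> y \<in> \<Q> \<Longrightarrow> dd1 q d l (x, y) \<in> \<Q>"
  by (cases x rule: quad_cases; cases y rule: quad_cases) (simp add: dd1_eq Q_carrier_iff holo2_intros)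

lemma continuous_map_dd0: "continuous_map (Q_top Ux Uy) (QQ_top Ux Uy) (dd0 q d l)"
proof -
  note proj = continuous_map_Q_top_proj[OF continuous_map_id[unfolded id_def]]
  show ?thesis unfolding QQ_top_def dd0_eq[abs_def]
    using dd0_in[unfolded dd0_eq]
    by (intro continuous_map_pairedI continuous_map_into_Q_top continuous_map_lcu_const
        continuous_map_lcu_mult proj continuous_intros) auto
qed

lemma continuous_map_QQ_top_proj:
  "continuous_map (QQ_top Ux Uy) (Q_top Ux Uy) fst" "continuous_map (QQ_top Ux Uy) (Q_top Ux Uy) snd"
  unfolding QQ_top_def by (intro continuous_map_fst continuous_map_snd)+

lemma continuous_map_dd1: "continuous_map (QQ_top Ux Uy) (Q_top Ux Uy) (dd1 q d l)"
proof -
  note proj = continuous_map_QQ_top_proj[THEN continuous_map_Q_top_proj(1)]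
    continuous_map_QQ_top_proj[THEN continuous_map_Q_top_proj(2)]
    continuous_map_QQ_top_proj[THEN continuous_map_Q_top_proj(3)]
    continuous_map_QQ_top_proj[THEN continuous_map_Q_top_proj(4)]
  show ?thesis unfolding dd1_eq[abs_def]
    using dd1_in[unfolded dd1_eq]
    by (intro continuous_map_into_Q_top continuous_map_lcu_diff
        continuous_map_lcu_mult proj continuous_intros) auto
qed

lemma pi_in:
  assumes "x \<in> \<Q>"
  shows "pi_dl q d l Ux Uy x \<in> O_carrier Ux Uy"
proof -
  obtain x1 x2 x3 x4 where x: "x = ((x1, x2), (x3, x4))" by (rule quad_cases)
  have Q: "((x1, x2), (x3, x4)) \<in> \<Q>" using assms x by simp
  have "(\<lambda>z. x1 (z, q ^ d * z)) holomorphic_on Ux"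
    by (rule holo2_curve_holomorphic[of "Ux \<times> Ux"]) (use Q in \<open>auto simp: Q_carrier_iff open_U intro!: holomorphic_intros\<close>)
  moreover have "(\<lambda>w. x4 (q ^ l * w, w)) holomorphic_on Uy"
    by (rule holo2_curve_holomorphic[of "Uy \<times> Uy"]) (use Q in \<open>auto simp: Q_carrier_iff open_U intro!: holomorphic_intros\<close>)
  \<comment> \<open>The gluing conditions link the two corners through
    \<open>x2 (0, 0)\<close>.\<close>
  moreover have "x1 (0, 0) = x4 (0, 0)" using Q by (simp add: Q_carrier_iff)
  ultimately show ?thesis
    by (auto simp: O_carrier_def pi_dl_def x elim: holomorphic_transform)
qed

lemma continuous_map_pi: "continuous_map (Q_top Ux Uy) (O_top Ux Uy) (pi_dl q d l Ux Uy)"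
proof -
  note proj = continuous_map_Q_top_proj[OF continuous_map_id[unfolded id_def]]
  show ?thesis unfolding pi_dl_def[abs_def]
  proof (rule continuous_map_into_O_top)
    have "continuous_map (Q_top Ux Uy) (lcu_topology Ux) (\<lambda>x z. fst (fst x) (z, q ^ d * z))"
      by (rule continuous_map_lcu_reindex[OF proj(1)]) (auto intro!: continuous_intros)
    then show "continuous_map (Q_top Ux Uy) (lcu_topology Ux)
        (\<lambda>x z. if z \<in> Ux then fst (fst x) (z, q ^ d * z) else 0)"
      by (rule continuous_map_lcu_cong) simp
    have "continuous_map (Q_top Ux Uy) (lcu_topology Uy) (\<lambda>x w. snd (snd x) (q ^ l * w, w))"
      by (rule continuous_map_lcu_reindex[OF proj(4)]) (auto intro!: continuous_intros)
    then show "continuous_map (Q_top Ux Uy) (lcu_topology Uy)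
        (\<lambda>x w. if w \<in> Uy then snd (snd x) (q ^ l * w, w) else 0)"
      by (rule continuous_map_lcu_cong) simp
  qed (use pi_in[unfolded pi_dl_def] in simp)
qed

text \<open>The first and last components of \<open>dd1\<close> carry factors that vanish on exactly
  the lines along which \<open>pi_dl\<close> evaluates.\<close>

lemma pi_dd1: "pi_dl q d l Ux Uy (dd1 q d l p) = ozero"
  by (auto simp: pi_dl_def dd1_eq ozero_def)

section \<open>Exactness in degrees zero, two and three\<close>

lemma dd0_inj:
  assumes "x \<in> \<Q>" "dd0 q d l x = (qzero, qzero)"
  shows "x = qzero"
proof -
  obtain x1 x2 x3 x4 where x: "x = ((x1, x2), (x3, x4))" by (rule quad_cases)
  have Q: "((x1, x2), (x3, x4)) \<in> \<Q>" using assms x by simp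
  \<comment> \<open>One equation is selected for each component: that for \<open>x1\<close> from the
    second entry of \<open>dd0\<close>, the others from the first. Each is multiplication by a
    nonzero linear form, which cancels.\<close>
  have eq: "(snd p - q ^ (d + 1) * fst p) * x1 p = 0" "- (q ^ (l + 1)) * (snd p * x2 p) = 0"
    "fst p * x3 p = 0" "(fst p - q ^ (l + 1) * snd p) * x4 p = 0" for p
    using assms(2) unfolding dd0_eq qzero_def x by (simp_all only: prod.inject fst_conv snd_conv fun_eq_iff)
  have "x1 = (\<lambda>_. 0)"
    by (rule mult_line_snd_eq_0_fun[of Ux Ux _ "q ^ (d + 1)"]) (use Q eq in \<open>auto simp: Q_carrier_iff open_U\<close>)
  moreover have "x2 = (\<lambda>_. 0)"
    by (rule mult_line_snd_eq_0_fun[of Ux Uy _ 0]) (use Q eq(2) in \<open>auto simp: Q_carrier_iff open_U\<close>)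
  moreover have "x3 = (\<lambda>_. 0)"
    by (rule mult_line_fst_eq_0_fun[of Uy Ux _ 0]) (use Q eq(3) in \<open>auto simp: Q_carrier_iff open_U\<close>)
  moreover have "x4 = (\<lambda>_. 0)"
    by (rule mult_line_fst_eq_0_fun[of Uy Uy _ "q ^ (l + 1)"]) (use Q eq in \<open>auto simp: Q_carrier_iff open_U\<close>)
  ultimately show ?thesis by (simp add: x qzero_def)
qed

lemma pi_surj:
  assumes "y \<in> O_carrier Ux Uy"
  shows "y \<in> pi_dl q d l Ux Uy ` \<Q>"
proof -
  obtain f g where y: "y = (f, g)" by (cases y)
  have f: "f holomorphic_on Ux" "\<And>z. z \<notin> Ux \<Longrightarrow> f z = 0"
    and g: "g holomorphic_on Uy" "\<And>z. z \<notin> Uy \<Longrightarrow> g z = 0" and fg: "g 0 = f 0"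
    using assms by (auto simp: O_carrier_def y)
  \<comment> \<open>This is \<open>f\<close> in the first variable plus \<open>g\<close> in the
    second minus the constant \<open>f 0\<close>, where \<open>f\<close> is continued by
    \<open>f 0\<close> to the \<open>w\<close>-branch and \<open>g\<close> by \<open>g 0\<close> to
    the \<open>z\<close>-branch.\<close>
  define x where "x =
    ((\<lambda>p. if p \<in> Ux \<times> Ux then f (fst p) else 0,
      \<lambda>p. if p \<in> Ux \<times> Uy then f (fst p) + g (snd p) - f 0 else 0),
     (\<lambda>p. if p \<in> Uy \<times> Ux then f 0 else 0, \<lambda>p. if p \<in> Uy \<times> Uy then g (snd p) else 0))"
  have "x \<in> \<Q>"
    unfolding x_def Q_carrier_iff
    by (intro conjI holo2_if holo2_intros holo2_of_fst holo2_of_snd f g open_U open_UU)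
       (auto simp: fg)
  moreover have "pi_dl q d l Ux Uy x = y"
    using f(2) g(2) by (auto simp: pi_dl_def x_def y fun_eq_iff)
  ultimately show ?thesis by blast
qed

text \<open>Vanishing of \<open>pi_dl\<close> is the divisibility that solves the first and last
  component equations for \<open>a1\<close> and \<open>b4\<close>. In the mixed components the
  restrictions to the axes equal those of \<open>x1\<close> and \<open>x4\<close> by gluing, hence
  are already multiples of \<open>a1\<close> and \<open>b4\<close> there. Only a multiple of the
  product of both coordinates remains, and it is absorbed into \<open>a2\<close> or
  \<open>a3\<close>.\<close>

lemma ker_pi:
  assumes "x \<in> \<Q>" "pi_dl q d l Ux Uy x = ozero"
  shows "x \<in> dd1 q d l ` (\<Q> \<times> \<Q>)"
proof -
  obtain x1 x2 x3 x4 where x: "x = ((x1, x2), (x3, x4))" by (rule quad_cases)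
  have Q: "((x1, x2), (x3, x4)) \<in> \<Q>" using assms x by simp
  have h: "holo2 (Ux \<times> Ux) x1" "holo2 (Ux \<times> Uy) x2" "holo2 (Uy \<times> Ux) x3" "holo2 (Uy \<times> Uy) x4"
    and nul: "\<And>p. p \<notin> Ux \<times> Ux \<Longrightarrow> x1 p = 0" "\<And>p. p \<notin> Ux \<times> Uy \<Longrightarrow> x2 p = 0"
      "\<And>p. p \<notin> Uy \<times> Ux \<Longrightarrow> x3 p = 0" "\<And>p. p \<notin> Uy \<times> Uy \<Longrightarrow> x4 p = 0"
    and comp: "\<And>a. a \<in> Ux \<Longrightarrow> x1 (a, 0) = x2 (a, 0)" "\<And>a. a \<in> Uy \<Longrightarrow> x3 (a, 0) = x4 (a, 0)"
      "\<And>a. a \<in> Ux \<Longrightarrow> x1 (0, a) = x3 (0, a)" "\<And>a. a \<in> Uy \<Longrightarrow> x2 (0, a) = x4 (0, a)"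
    using Q by (auto simp: Q_carrier_iff)
  have "(\<lambda>z. if z \<in> Ux then x1 (z, q ^ d * z) else 0) = (\<lambda>_. 0)"
    "(\<lambda>w. if w \<in> Uy then x4 (q ^ l * w, w) else 0) = (\<lambda>_. 0)"
    using assms(2)[unfolded pi_dl_def ozero_def x fst_conv snd_conv prod.inject] by blast+
  note z = this[THEN fun_cong]
  have z1: "x1 (z, q ^ d * z) = 0" if "z \<in> Ux" for z using z(1)[of z] that by simp
  have z4: "x4 (q ^ l * w, w) = 0" if "w \<in> Uy" for w using z(2)[of w] that by simp
  obtain a1 where a1: "holo2 (Ux \<times> Ux) a1" "\<And>p. p \<notin> Ux \<times> Ux \<Longrightarrow> a1 p = 0"
    "\<And>p. x1 p = (snd p - q ^ d * fst p) * a1 p"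
    by (rule factor_line_snd[OF open_U(1,1) h(1) nul(1), of "q ^ d"]) (assumption, rule z1, assumption, rule that)
  obtain b4 where b4: "holo2 (Uy \<times> Uy) b4" "\<And>p. p \<notin> Uy \<times> Uy \<Longrightarrow> b4 p = 0"
    "\<And>p. x4 p = (fst p - q ^ l * snd p) * b4 p"
    by (rule factor_line_fst[OF open_U(2,2) h(4) nul(4), of "q ^ l"]) (assumption, rule z4, assumption, rule that)
  have x00: "x2 (0, 0) = 0" "x3 (0, 0) = 0"
    using z1[of 0] comp(1)[of 0] comp(3)[of 0] by auto
  obtain r2 where r2: "holo2 (Ux \<times> Uy) r2"
    "\<And>z w. z \<in> Ux \<Longrightarrow> w \<in> Uy \<Longrightarrow> x2 (z, w) = x2 (z, 0) + x2 (0, w) + z * w * r2 (z, w)"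
    by (rule split_along_axes[OF open_U(1) zero_U(1) open_U(2) zero_U(2) h(2) x00(1)]) (rule that)
  obtain r3 where r3: "holo2 (Uy \<times> Ux) r3"
    "\<And>w z. w \<in> Uy \<Longrightarrow> z \<in> Ux \<Longrightarrow> x3 (w, z) = x3 (w, 0) + x3 (0, z) + w * z * r3 (w, z)"
    by (rule split_along_axes[OF open_U(2) zero_U(2) open_U(1) zero_U(1) h(3) x00(2)]) (rule that)
  \<comment> \<open>The term \<open>- q ^ d * z1 * a2\<close> must produce
    \<open>x1 (z, 0) = - q ^ d * z * a1 (z, 0)\<close> and the remainder \<open>z * w * r2\<close>;
    hence the factor \<open>- 1 / q ^ d\<close>.\<close>
  define a2 where "a2 p = (if p \<in> Ux \<times> Uy then a1 (fst p, 0) - (1 / q ^ d) * (snd p * r2 p) else 0)" for p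
  define a3 where "a3 p = (if p \<in> Uy \<times> Ux then a1 (0, snd p) + fst p * r3 p else 0)" for p
  \<comment> \<open>\<open>a4\<close> does not occur in \<open>dd1\<close>. It only has to glue: it
    is the sum of the prescribed restrictions of \<open>a3\<close> and \<open>a2\<close> to the
    axes, minus their common value at 0.\<close>
  define a4 where "a4 p = (if p \<in> Uy \<times> Uy then
      a1 (0, 0) + fst p * r3 (fst p, 0) - (1 / q ^ d) * (snd p * r2 (0, snd p)) else 0)" for p
  \<comment> \<open>\<open>b1\<close> is likewise absent from \<open>dd1\<close>. The functions
    \<open>b2\<close> and \<open>b3\<close> are constant, equal to \<open>- b4 (0, 0)\<close>, on
    the axes where \<open>b1\<close> meets them, so a constant glues.\<close>
  define b1 where "b1 p = (if p \<in> Ux \<times> Ux then - b4 (0, 0) else 0)" for p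
  define b2 where "b2 p = (if p \<in> Ux \<times> Uy then - b4 (0, snd p) else 0)" for p
  define b3 where "b3 p = (if p \<in> Uy \<times> Ux then - b4 (fst p, 0) else 0)" for p
  have a: "((a1, a2), (a3, a4)) \<in> \<Q>"
    unfolding Q_carrier_iff a2_def[abs_def] a3_def[abs_def] a4_def[abs_def]
    by (intro conjI holo2_if holo2_intros open_UU a1(1) r2(1) r3(1) holo2_fst_axis[OF a1(1)]
        holo2_snd_axis[OF a1(1)] holo2_fst_axis[OF r3(1)] holo2_snd_axis[OF r2(1)] zero_U)
       (auto simp: a1(2))
  have b: "((b1, b2), (b3, \<lambda>p. - b4 p)) \<in> \<Q>"
    unfolding Q_carrier_iff b1_def[abs_def] b2_def[abs_def] b3_def[abs_def]
    by (intro conjI holo2_if holo2_intros open_UU b4(1) holo2_fst_axis[OF b4(1)]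
        holo2_snd_axis[OF b4(1)] zero_U)
       (auto simp: b4(2))
  have "dd1 q d l (((a1, a2), (a3, a4)), ((b1, b2), (b3, \<lambda>p. - b4 p))) = x"
  proof -
    have "q ^ l * (snd p * b2 p) - q ^ d * (fst p * a2 p) = x2 p" for p
    proof (cases "p \<in> Ux \<times> Uy")
      case True
      then obtain z w where p: "p = (z, w)" "z \<in> Ux" "w \<in> Uy" by auto
      have "x2 p = x1 (z, 0) + x4 (0, w) + z * w * r2 p"
        using r2(2)[of z w] comp(1)[of z] comp(4)[of w] p by simp
      then show ?thesis using True p by (simp add: a2_def b2_def a1(3) b4(3) algebra_simps)
    qed (simp add: a2_def b2_def nul)
    moreover have "snd p * a3 p - fst p * b3 p = x3 p" for p
    proof (cases "p \<in> Uy \<times> Ux")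
      case True
      then obtain w z where p: "p = (w, z)" "z \<in> Ux" "w \<in> Uy" by auto
      have "x3 p = x4 (w, 0) + x1 (0, z) + w * z * r3 p"
        using r3(2)[of w z] comp(2)[of w] comp(3)[of z] p by simp
      then show ?thesis using True p by (simp add: a3_def b3_def a1(3) b4(3) algebra_simps)
    qed (simp add: a3_def b3_def nul)
    ultimately show ?thesis by (auto simp: dd1_eq x a1(3) b4(3) algebra_simps)
  qed
  from this[symmetric] show ?thesis by (rule image_eqI) (rule SigmaI[OF a b])
qed

text \<open>On the kernel of \<open>dd1\<close> the components \<open>zeta1\<close> and \<open>eta4\<close> vanish, hence the mixed
  components are divisible by coordinates.\<close>

lemma K1_structure:
  assumes "p \<in> K1"
  obtains A B z4 e1 where
    "p = (((\<lambda>_. 0, \<lambda>p. snd p * A p), (\<lambda>p. fst p * B p, z4)),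
          ((e1, \<lambda>p. q ^ d / q ^ l * (fst p * A p)), (\<lambda>p. snd p * B p, \<lambda>_. 0)))"
    "holo2 (Ux \<times> Uy) A" "holo2 (Uy \<times> Ux) B" "holo2 (Uy \<times> Uy) z4" "holo2 (Ux \<times> Ux) e1"
    "\<And>p. p \<notin> Ux \<times> Uy \<Longrightarrow> A p = 0" "\<And>p. p \<notin> Uy \<times> Ux \<Longrightarrow> B p = 0"
    "\<And>p. p \<notin> Uy \<times> Uy \<Longrightarrow> z4 p = 0" "\<And>p. p \<notin> Ux \<times> Ux \<Longrightarrow> e1 p = 0"
    "\<And>w. w \<in> Uy \<Longrightarrow> z4 (w, 0) = w * B (w, 0)" "\<And>w. w \<in> Uy \<Longrightarrow> z4 (0, w) = w * A (0, w)"
    "\<And>z. z \<in> Ux \<Longrightarrow> e1 (z, 0) = z * (q ^ d / q ^ l * A (z, 0))"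
    "\<And>z. z \<in> Ux \<Longrightarrow> e1 (0, z) = z * B (0, z)"
proof -
  obtain x y where p_eq: "p = (x, y)" by (cases p)
  obtain z1 z2 z3 z4 where x: "x = ((z1, z2), (z3, z4))" by (rule quad_cases)
  obtain e1 e2 e3 e4 where y: "y = ((e1, e2), (e3, e4))" by (rule quad_cases)
  have Qz: "((z1, z2), (z3, z4)) \<in> \<Q>" and Qe: "((e1, e2), (e3, e4)) \<in> \<Q>"
    using assms by (auto simp: K1_def p_eq x y)
  have z: "holo2 (Ux \<times> Ux) z1" "holo2 (Ux \<times> Uy) z2" "holo2 (Uy \<times> Ux) z3" "holo2 (Uy \<times> Uy) z4"
      "\<And>p. p \<notin> Ux \<times> Ux \<Longrightarrow> z1 p = 0" "\<And>p. p \<notin> Ux \<times> Uy \<Longrightarrow> z2 p = 0"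
      "\<And>p. p \<notin> Uy \<times> Ux \<Longrightarrow> z3 p = 0" "\<And>p. p \<notin> Uy \<times> Uy \<Longrightarrow> z4 p = 0"
      "\<And>a. a \<in> Ux \<Longrightarrow> z1 (a, 0) = z2 (a, 0)" "\<And>a. a \<in> Uy \<Longrightarrow> z3 (a, 0) = z4 (a, 0)"
      "\<And>a. a \<in> Ux \<Longrightarrow> z1 (0, a) = z3 (0, a)" "\<And>a. a \<in> Uy \<Longrightarrow> z2 (0, a) = z4 (0, a)"
    using Qz by (auto simp: Q_carrier_iff)
  have e: "holo2 (Ux \<times> Ux) e1" "holo2 (Ux \<times> Uy) e2" "holo2 (Uy \<times> Ux) e3" "holo2 (Uy \<times> Uy) e4"
      "\<And>p. p \<notin> Ux \<times> Ux \<Longrightarrow> e1 p = 0" "\<And>p. p \<notin> Ux \<times> Uy \<Longrightarrow> e2 p = 0"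
      "\<And>p. p \<notin> Uy \<times> Ux \<Longrightarrow> e3 p = 0" "\<And>p. p \<notin> Uy \<times> Uy \<Longrightarrow> e4 p = 0"
      "\<And>a. a \<in> Ux \<Longrightarrow> e1 (a, 0) = e2 (a, 0)" "\<And>a. a \<in> Uy \<Longrightarrow> e3 (a, 0) = e4 (a, 0)"
      "\<And>a. a \<in> Ux \<Longrightarrow> e1 (0, a) = e3 (0, a)" "\<And>a. a \<in> Uy \<Longrightarrow> e2 (0, a) = e4 (0, a)"
    using Qe by (auto simp: Q_carrier_iff)
  have "dd1 q d l p = qzero" using assms by (simp add: K1_def)
  then have eq: "(snd p - q ^ d * fst p) * z1 p = 0"
    "q ^ l * (snd p * e2 p) - q ^ d * (fst p * z2 p) = 0"
    "snd p * z3 p - fst p * e3 p = 0" "(q ^ l * snd p - fst p) * e4 p = 0" for p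
    unfolding p_eq x y dd1_eq qzero_def by (simp_all only: prod.inject fst_conv snd_conv fun_eq_iff)
  have z1: "z1 = (\<lambda>_. 0)"
    by (rule mult_line_snd_eq_0_fun[OF z(1) open_U(1) z(5) eq(1)])
  have e4: "e4 = (\<lambda>_. 0)"
    by (rule mult_line_fst_eq_0_fun[OF e(4) open_U(2) e(8), of "q ^ l"])
       (assumption, use eq(4) in \<open>metis mult_eq_0_iff right_minus_eq\<close>)
  obtain A where A: "holo2 (Ux \<times> Uy) A" "\<And>p. p \<notin> Ux \<times> Uy \<Longrightarrow> A p = 0"
    "\<And>p. z2 p = (snd p - 0 * fst p) * A p"
  proof (rule factor_line_snd[OF open_U z(2,6)])
    show "z2 (a, 0 * a) = 0" if "a \<in> Ux" for a using z(9)[OF that] z1 by simp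
  qed (assumption, rule that)
  obtain B where B: "holo2 (Uy \<times> Ux) B" "\<And>p. p \<notin> Uy \<times> Ux \<Longrightarrow> B p = 0"
    "\<And>p. z3 p = (fst p - 0 * snd p) * B p"
  proof (rule factor_line_fst[OF open_U(2,1) z(3,7)])
    show "z3 (0 * a, a) = 0" if "a \<in> Ux" for a using z(11)[OF that] z1 by simp
  qed (assumption, rule that)
  have z2: "z2 = (\<lambda>p. snd p * A p)" and z3: "z3 = (\<lambda>p. fst p * B p)"
    using A(3) B(3) by auto
  \<comment> \<open>With \<open>z2 = w2 * A\<close> the second kernel equation reads
    \<open>q ^ l * w2 * e2 = q ^ d * z1 * w2 * A\<close>, and \<open>w2\<close> cancels.\<close>
  have "(\<lambda>p. e2 p - q ^ d / q ^ l * (fst p * A p)) = (\<lambda>_. 0)"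
  proof (rule mult_line_snd_eq_0_fun[of Ux Uy _ 0])
    show "(snd p - 0 * fst p) * (e2 p - q ^ d / q ^ l * (fst p * A p)) = 0" for p
      using eq(2)[of p] by (simp add: z2 field_simps)
    show "holo2 (Ux \<times> Uy) (\<lambda>p. e2 p - q ^ d / q ^ l * (fst p * A p))"
      by (intro holo2_intros e A)
  qed (simp_all add: open_U e A(2))
  then have e2: "e2 = (\<lambda>p. q ^ d / q ^ l * (fst p * A p))"
    unfolding fun_eq_iff right_minus_eq .
  have "(\<lambda>p. e3 p - snd p * B p) = (\<lambda>_. 0)"
  proof (rule mult_line_fst_eq_0_fun[of Uy Ux _ 0])
    show "(fst p - 0 * snd p) * (e3 p - snd p * B p) = 0" for p
      using eq(3)[of p] by (auto simp: z3 algebra_simps)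
    show "holo2 (Uy \<times> Ux) (\<lambda>p. e3 p - snd p * B p)"
      by (intro holo2_intros e B)
  qed (simp_all add: open_U e B(2))
  then have e3: "e3 = (\<lambda>p. snd p * B p)"
    unfolding fun_eq_iff right_minus_eq .
  show ?thesis
  proof (rule that[OF _ A(1) B(1) z(4) e(1) A(2) B(2) z(8) e(5)])
    show "p = (((\<lambda>_. 0, \<lambda>p. snd p * A p), (\<lambda>p. fst p * B p, z4)),
          ((e1, \<lambda>p. q ^ d / q ^ l * (fst p * A p)), (\<lambda>p. snd p * B p, \<lambda>_. 0)))"
      by (simp only: p_eq x y z1 z2 z3 e2 e3 e4)
    show "z4 (w, 0) = w * B (w, 0)" if "w \<in> Uy" for w using z(10)[OF that] z3 by simp
    show "z4 (0, w) = w * A (0, w)" if "w \<in> Uy" for w using z(12)[OF that] z2 by simp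
    show "e1 (z, 0) = z * (q ^ d / q ^ l * A (z, 0))" if "z \<in> Ux" for z using e(9)[OF that] e2 by simp
    show "e1 (0, z) = z * B (0, z)" if "z \<in> Ux" for z using e(11)[OF that] e3 by simp
  qed
qed

section \<open>The map inducing the isomorphism on first cohomology\<close>

definition eta_trace :: "quad \<times> quad \<Rightarrow> fn1" where
  "eta_trace p = (\<lambda>z. fst (fst (snd p)) (z, q ^ (d + 1) * z))"

definition zeta_trace :: "quad \<times> quad \<Rightarrow> fn1" where
  "zeta_trace p = (\<lambda>w. snd (snd (fst p)) (q ^ (l + 1) * w, w))"

text \<open>With the notation of \<open>K1_structure\<close>, at 0 the two quotients take the values
  \<open>q\<^sup>d / q\<^sup>l * (A (0, 0) + q\<^sup>l\<^sup>+\<^sup>1 * B (0, 0))\<close> and \<open>A (0, 0) + q\<^sup>l\<^sup>+\<^sup>1 * B (0, 0)\<close>; the factor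
  \<open>q\<^sup>l / q\<^sup>d\<close> makes them agree.\<close>

definition Phi :: "quad \<times> quad \<Rightarrow> ofun" where
  "Phi p = (\<lambda>z. if z \<in> Ux then q ^ l / q ^ d * div0 (eta_trace p) z else 0,
            \<lambda>w. if w \<in> Uy then div0 (zeta_trace p) w else 0)"

lemma trace_holomorphic:
  assumes "p \<in> \<Q> \<times> \<Q>"
  shows "eta_trace p holomorphic_on Ux" "zeta_trace p holomorphic_on Uy"
proof -
  obtain z1 z2 z3 z4 e1 e2 e3 e4 where p: "p = (((z1, z2), (z3, z4)), ((e1, e2), (e3, e4)))"
    by (metis surj_pair)
  have h: "holo2 (Ux \<times> Ux) e1" "holo2 (Uy \<times> Uy) z4"
    using assms by (simp_all add: p Q_carrier_iff)
  have "(\<lambda>z. e1 (z, q ^ (d + 1) * z)) holomorphic_on Ux"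
    by (rule holo2_curve_holomorphic[OF h(1)]) (auto simp: open_U intro!: holomorphic_intros)
  moreover have "(\<lambda>w. z4 (q ^ (l + 1) * w, w)) holomorphic_on Uy"
    by (rule holo2_curve_holomorphic[OF h(2)]) (auto simp: open_U intro!: holomorphic_intros)
  ultimately show "eta_trace p holomorphic_on Ux" "zeta_trace p holomorphic_on Uy"
    by (simp_all add: eta_trace_def zeta_trace_def p)
qed

lemma trace_zero:
  assumes "p \<in> K1"
  shows "eta_trace p 0 = 0" "zeta_trace p 0 = 0"
proof -
  have "eta_trace p 0 = 0 \<and> zeta_trace p 0 = 0"
    using assms
  proof (rule K1_structure)
    fix A B z4 e1
    assume p: "p = (((\<lambda>_. 0, \<lambda>p. snd p * A p), (\<lambda>p. fst p * B p, z4)),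
          ((e1, \<lambda>p. q ^ d / q ^ l * (fst p * A p)), (\<lambda>p. snd p * B p, \<lambda>_. 0)))"
      and axes: "\<And>w. w \<in> Uy \<Longrightarrow> z4 (0, w) = w * A (0, w)" "\<And>z. z \<in> Ux \<Longrightarrow> e1 (0, z) = z * B (0, z)"
    show ?thesis
      using axes(1)[of 0] axes(2)[of 0] by (simp add: eta_trace_def zeta_trace_def p)
  qed
  then show "eta_trace p 0 = 0" "zeta_trace p 0 = 0" by auto
qed

text \<open>The derivative at 0 of a trace is a directional derivative of \<open>eta1\<close> or
  \<open>zeta4\<close>, hence determined by the restrictions to the axes. Gluing expresses these for
  both functions through the same \<open>A\<close> and \<open>B\<close>, and this shared data forces
  the equality at 0.\<close>

lemma Phi_in:
  assumes "p \<in> K1"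
  shows "Phi p \<in> O_carrier Ux Uy"
proof -
  have pQ: "p \<in> \<Q> \<times> \<Q>" using assms by (simp add: K1_def)
  have hx: "div0 (eta_trace p) holomorphic_on Ux" and hy: "div0 (zeta_trace p) holomorphic_on Uy"
    by (intro div0_holomorphic trace_holomorphic pQ open_U trace_zero assms)+
  have "q ^ l / q ^ d * div0 (eta_trace p) 0 = div0 (zeta_trace p) 0"
    using assms
  proof (rule K1_structure)
    fix A B z4 e1
    assume p: "p = (((\<lambda>_. 0, \<lambda>p. snd p * A p), (\<lambda>p. fst p * B p, z4)),
          ((e1, \<lambda>p. q ^ d / q ^ l * (fst p * A p)), (\<lambda>p. snd p * B p, \<lambda>_. 0)))"
      and h: "holo2 (Ux \<times> Uy) A" "holo2 (Uy \<times> Ux) B" "holo2 (Uy \<times> Uy) z4" "holo2 (Ux \<times> Ux) e1"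
      and axes: "\<And>w. w \<in> Uy \<Longrightarrow> z4 (w, 0) = w * B (w, 0)" "\<And>w. w \<in> Uy \<Longrightarrow> z4 (0, w) = w * A (0, w)"
        "\<And>z. z \<in> Ux \<Longrightarrow> e1 (z, 0) = z * (q ^ d / q ^ l * A (z, 0))"
        "\<And>z. z \<in> Ux \<Longrightarrow> e1 (0, z) = z * B (0, z)"
    note slices = holo2_slice_fst[OF h(1) open_U(1) zero_U(2)] holo2_slice_snd[OF h(1) open_U(2) zero_U(1)]
      holo2_slice_fst[OF h(2) open_U(2) zero_U(1)] holo2_slice_snd[OF h(2) open_U(1) zero_U(2)]
    \<comment> \<open>Direction \<open>(1, q ^ (d + 1))\<close> for \<open>eta1\<close>; below,
      \<open>(q ^ (l + 1), 1)\<close> for \<open>zeta4\<close>. The trivial factors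
      \<open>1 *\<close> fit the form of \<open>deriv_along_line\<close>.\<close>
    have "deriv (\<lambda>z. e1 (1 * z, q ^ (d + 1) * z)) 0 = 1 * (q ^ d / q ^ l * A (0, 0)) + q ^ (d + 1) * B (0, 0)"
      by (rule deriv_along_line[OF open_U(1) zero_U(1) open_U(1) zero_U(1) h(4),
            where g = "\<lambda>z. q ^ d / q ^ l * A (z, 0)" and h = "\<lambda>z. B (0, z)"])
         (intro holomorphic_intros slices axes; assumption)+
    then have "div0 (eta_trace p) 0 = q ^ d / q ^ l * A (0, 0) + q ^ (d + 1) * B (0, 0)"
      by (simp add: div0_def eta_trace_def p)
    moreover have "deriv (\<lambda>z. z4 (q ^ (l + 1) * z, 1 * z)) 0 = q ^ (l + 1) * B (0, 0) + 1 * A (0, 0)"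
      by (rule deriv_along_line[OF open_U(2) zero_U(2) open_U(2) zero_U(2) h(3),
            where g = "\<lambda>w. B (w, 0)" and h = "\<lambda>w. A (0, w)"])
         (intro slices axes; assumption)+
    then have "div0 (zeta_trace p) 0 = q ^ (l + 1) * B (0, 0) + A (0, 0)"
      by (simp add: div0_def zeta_trace_def p)
    ultimately show ?thesis by (simp add: field_simps)
  qed
  moreover have "(\<lambda>z. q ^ l / q ^ d * div0 (eta_trace p) z) holomorphic_on Ux"
    using hx by (intro holomorphic_intros)
  ultimately show ?thesis using hy
    by (auto simp: O_carrier_def Phi_def elim: holomorphic_transform)
qed

lemma Phi_linear:
  assumes "x \<in> K1" "y \<in> K1"
  shows "Phi (qadd (qscale c (fst x)) (fst y), qadd (qscale c (snd x)) (snd y))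
              = oadd (oscale c (Phi x)) (Phi y)" (is "Phi ?p = _")
proof -
  have Q: "x \<in> \<Q> \<times> \<Q>" "y \<in> \<Q> \<times> \<Q>" using assms by (auto simp: K1_def)
  have tr: "eta_trace ?p = (\<lambda>z. c * eta_trace x z + eta_trace y z)"
    "zeta_trace ?p = (\<lambda>z. c * zeta_trace x z + zeta_trace y z)"
    by (simp_all add: eta_trace_def zeta_trace_def qadd_def qscale_def case_prod_unfold)
  have "div0 (\<lambda>z. c * eta_trace x z + eta_trace y z) z = c * div0 (eta_trace x) z + div0 (eta_trace y) z"
    "div0 (\<lambda>z. c * zeta_trace x z + zeta_trace y z) z = c * div0 (zeta_trace x) z + div0 (zeta_trace y) z" for z
    by (rule div0_lincomb[of _ Ux] div0_lincomb[of _ Uy]; intro trace_holomorphic Q open_U zero_U)+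
  then show ?thesis unfolding Phi_def tr
    by (simp add: oadd_def oscale_def fun_eq_iff algebra_simps add_divide_distrib)
qed

text \<open>In \<open>dd0\<close> the components \<open>eta1\<close> and \<open>zeta4\<close> carry
  the linear forms of the two trace lines, so both traces are identically 0.\<close>

lemma dd0_in_ker_Phi:
  assumes "x \<in> \<Q>"
  shows "dd0 q d l x \<in> K1" "Phi (dd0 q d l x) = ozero"
proof -
  show "dd0 q d l x \<in> K1" using dd0_in[OF assms] by (simp add: K1_def dd1_dd0)
  have "eta_trace (dd0 q d l x) = (\<lambda>z. 0)" "zeta_trace (dd0 q d l x) = (\<lambda>z. 0)"
    by (simp_all add: eta_trace_def zeta_trace_def dd0_eq)
  moreover have "div0 (\<lambda>z. 0) z = 0" for z by (simp add: div0_def)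
  ultimately show "Phi (dd0 q d l x) = ozero" by (simp add: Phi_def ozero_def cong: if_cong)
qed

text \<open>Once both traces vanish, \<open>eta1\<close> and \<open>zeta4\<close> factor and give
  \<open>x1\<close> and \<open>x4\<close>, while the mixed components dictate \<open>x2\<close> and
  \<open>x3 = B\<close>. What remains is that these four independently obtained functions
  glue.\<close>

lemma ker_Phi:
  assumes pK: "p \<in> K1" and "Phi p = ozero"
  shows "p \<in> dd0 q d l ` \<Q>"
proof -
  have pQ: "p \<in> \<Q> \<times> \<Q>" using pK by (simp add: K1_def)
  have "(\<lambda>z. if z \<in> Ux then q ^ l / q ^ d * div0 (eta_trace p) z else 0) = (\<lambda>_. 0)"
    "(\<lambda>w. if w \<in> Uy then div0 (zeta_trace p) w else 0) = (\<lambda>_. 0)"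
    using assms(2)[unfolded Phi_def ozero_def prod.inject] by blast+
  note vanish = this[THEN fun_cong]
  have eta0: "eta_trace p z = 0" if "z \<in> Ux" for z
    using vanish(1)[of z] that trace_zero(1)[OF pK] by (cases "z = 0") (simp_all add: div0_def)
  have zeta0: "zeta_trace p w = 0" if "w \<in> Uy" for w
    using vanish(2)[of w] that trace_zero(2)[OF pK] by (cases "w = 0") (simp_all add: div0_def)
  show ?thesis using pK
  proof (rule K1_structure)
    fix A B z4 e1
    assume p: "p = (((\<lambda>_. 0, \<lambda>p. snd p * A p), (\<lambda>p. fst p * B p, z4)),
          ((e1, \<lambda>p. q ^ d / q ^ l * (fst p * A p)), (\<lambda>p. snd p * B p, \<lambda>_. 0)))"
      and h: "holo2 (Ux \<times> Uy) A" "holo2 (Uy \<times> Ux) B" "holo2 (Uy \<times> Uy) z4" "holo2 (Ux \<times> Ux) e1"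
      and nul: "\<And>p. p \<notin> Ux \<times> Uy \<Longrightarrow> A p = 0" "\<And>p. p \<notin> Uy \<times> Ux \<Longrightarrow> B p = 0"
        "\<And>p. p \<notin> Uy \<times> Uy \<Longrightarrow> z4 p = 0" "\<And>p. p \<notin> Ux \<times> Ux \<Longrightarrow> e1 p = 0"
      and axes: "\<And>w. w \<in> Uy \<Longrightarrow> z4 (w, 0) = w * B (w, 0)" "\<And>w. w \<in> Uy \<Longrightarrow> z4 (0, w) = w * A (0, w)"
        "\<And>z. z \<in> Ux \<Longrightarrow> e1 (z, 0) = z * (q ^ d / q ^ l * A (z, 0))"
        "\<And>z. z \<in> Ux \<Longrightarrow> e1 (0, z) = z * B (0, z)"
    have e0: "e1 (z, q ^ (d + 1) * z) = 0" if "z \<in> Ux" for z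
      using eta0[OF that] by (simp add: eta_trace_def p)
    have z0: "z4 (q ^ (l + 1) * w, w) = 0" if "w \<in> Uy" for w
      using zeta0[OF that] by (simp add: zeta_trace_def p)
    obtain x1 where x1: "holo2 (Ux \<times> Ux) x1" "\<And>p. p \<notin> Ux \<times> Ux \<Longrightarrow> x1 p = 0"
      "\<And>p. e1 p = (snd p - q ^ (d + 1) * fst p) * x1 p"
      by (rule factor_line_snd[OF open_U(1,1) h(4) nul(4), of "q ^ (d + 1)"])
         (assumption, rule e0, assumption, rule that)
    obtain x4 where x4: "holo2 (Uy \<times> Uy) x4" "\<And>p. p \<notin> Uy \<times> Uy \<Longrightarrow> x4 p = 0"
      "\<And>p. z4 p = (fst p - q ^ (l + 1) * snd p) * x4 p"
      by (rule factor_line_fst[OF open_U(2,2) h(3) nul(3), of "q ^ (l + 1)"])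
         (assumption, rule z0, assumption, rule that)
    \<comment> \<open>Forced by \<open>w2 * A = - q ^ (l + 1) * w2 * x2\<close>. The
      \<open>eta2\<close> equation then holds too, because
      \<open>q ^ (d + 1) / q ^ (l + 1) = q ^ d / q ^ l\<close>.\<close>
    define x2 where "x2 p = - (1 / q ^ (l + 1)) * A p" for p
    note slice = holo2_slice_fst[THEN holomorphic_on_imp_continuous_on]
      holo2_slice_snd[THEN holomorphic_on_imp_continuous_on]
    have hx2: "holo2 (Ux \<times> Uy) x2" unfolding x2_def[abs_def] by (intro holo2_intros h)
    \<comment> \<open>Each gluing condition follows from an axis relation of the cocycle after
      dividing by the coordinate; this is legitimate off 0 and extends to 0 by continuity.\<close>
    have c1: "x1 (z, 0) - x2 (z, 0) = 0" if "z \<in> Ux" for z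
    proof (rule continuous_eq_0_at_puncture[OF open_U(1) _ _ that, of "\<lambda>z. x1 (z, 0) - x2 (z, 0)" 0])
      show "continuous_on Ux (\<lambda>z. x1 (z, 0) - x2 (z, 0))"
        by (intro continuous_on_diff slice(1)[OF x1(1)] slice(1)[OF hx2] open_U zero_U)
      fix z assume z: "z \<in> Ux" "z \<noteq> 0"
      have "z * (q ^ (d + 1) * (x1 (z, 0) - x2 (z, 0))) = z * (q ^ d / q ^ l * A (z, 0)) - e1 (z, 0)"
        by (simp add: x2_def x1(3) field_simps)
      then have "z * (q ^ (d + 1) * (x1 (z, 0) - x2 (z, 0))) = 0"
        using axes(3)[OF z(1)] by (simp only: diff_self)
      then show "x1 (z, 0) - x2 (z, 0) = 0" using z by simp
    qed
    have c2: "x1 (0, z) - B (0, z) = 0" if "z \<in> Ux" for z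
    proof (rule continuous_eq_0_at_puncture[OF open_U(1) _ _ that, of "\<lambda>z. x1 (0, z) - B (0, z)" 0])
      show "continuous_on Ux (\<lambda>z. x1 (0, z) - B (0, z))"
        by (intro continuous_on_diff slice(2)[OF x1(1)] slice(2)[OF h(2)] open_U zero_U)
      fix z assume z: "z \<in> Ux" "z \<noteq> 0"
      then show "x1 (0, z) - B (0, z) = 0"
        using axes(4)[OF z(1)] x1(3)[of "(0, z)"] by simp
    qed
    have c3: "x4 (w, 0) - B (w, 0) = 0" if "w \<in> Uy" for w
    proof (rule continuous_eq_0_at_puncture[OF open_U(2) _ _ that, of "\<lambda>w. x4 (w, 0) - B (w, 0)" 0])
      show "continuous_on Uy (\<lambda>w. x4 (w, 0) - B (w, 0))"
        by (intro continuous_on_diff slice(1)[OF x4(1)] slice(1)[OF h(2)] open_U zero_U)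
      fix w assume w: "w \<in> Uy" "w \<noteq> 0"
      then show "x4 (w, 0) - B (w, 0) = 0"
        using axes(1)[OF w(1)] x4(3)[of "(w, 0)"] by simp
    qed
    have c4: "x4 (0, w) - x2 (0, w) = 0" if "w \<in> Uy" for w
    proof (rule continuous_eq_0_at_puncture[OF open_U(2) _ _ that, of "\<lambda>w. x4 (0, w) - x2 (0, w)" 0])
      show "continuous_on Uy (\<lambda>w. x4 (0, w) - x2 (0, w))"
        by (intro continuous_on_diff slice(2)[OF x4(1)] slice(2)[OF hx2] open_U zero_U)
      fix w assume w: "w \<in> Uy" "w \<noteq> 0"
      have "w * (q ^ (l + 1) * (x4 (0, w) - x2 (0, w))) = w * A (0, w) - z4 (0, w)"
        by (simp add: x2_def x4(3) field_simps)
      then have "w * (q ^ (l + 1) * (x4 (0, w) - x2 (0, w))) = 0"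
        using axes(2)[OF w(1)] by (simp only: diff_self)
      then show "x4 (0, w) - x2 (0, w) = 0" using w by simp
    qed
    have "x2 p = 0" if "p \<notin> Ux \<times> Uy" for p using nul(1)[OF that] by (simp add: x2_def)
    then have "((x1, x2), (B, x4)) \<in> \<Q>"
      unfolding Q_carrier_iff using c1 c2 c3 c4 x1(1,2) x4(1,2) hx2 h(2) nul(2) by simp
    moreover have "p = dd0 q d l ((x1, x2), (B, x4))"
      by (simp add: p dd0_eq x2_def fun_eq_iff x1(3) x4(3) field_simps)
    ultimately show ?thesis by (rule image_eqI[rotated])
  qed
qed

text \<open>For \<open>y = (f, g)\<close> this is the normal form of \<open>K1_structure\<close>
  with \<open>A = f(z1) + g(w2) - f 0\<close> and \<open>B = 0\<close>. Then
  \<open>zeta4 = w2 * g(w2)\<close> and \<open>eta1 = q ^ d / q ^ l * z1 * f(z1)\<close> satisfy the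
  axis relations, and their traces divided by the coordinate return \<open>g\<close> and
  \<open>q ^ d / q ^ l * f\<close>.\<close>

definition lift :: "ofun \<Rightarrow> quad \<times> quad" where
  "lift y = (((\<lambda>p. 0, \<lambda>p. if p \<in> Ux \<times> Uy then snd p * (fst y (fst p) + snd y (snd p) - fst y 0) else 0),
              (\<lambda>p. 0, \<lambda>p. if p \<in> Uy \<times> Uy then snd p * snd y (snd p) else 0)),
             ((\<lambda>p. if p \<in> Ux \<times> Ux then q ^ d / q ^ l * (fst p * fst y (fst p)) else 0,
               \<lambda>p. if p \<in> Ux \<times> Uy then q ^ d / q ^ l * (fst p * (fst y (fst p) + snd y (snd p) - fst y 0)) else 0),
              (\<lambda>p. 0, \<lambda>p. 0)))"

lemma lift_in:
  assumes "y \<in> O_carrier Ux Uy"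
  shows "lift y \<in> K1"
proof -
  have y: "fst y holomorphic_on Ux" "snd y holomorphic_on Uy" "snd y 0 = fst y 0"
    using assms by (auto simp: O_carrier_def)
  have "fst (lift y) \<in> \<Q>"
    unfolding lift_def fst_conv Q_carrier_iff
    by (intro conjI holo2_if holo2_intros holo2_of_fst holo2_of_snd y open_U open_UU) (auto simp: y)
  moreover have "snd (lift y) \<in> \<Q>"
    unfolding lift_def snd_conv Q_carrier_iff
    by (intro conjI holo2_if holo2_intros holo2_of_fst holo2_of_snd y open_U open_UU) (auto simp: y)
  moreover have "dd1 q d l (lift y) = qzero"
    by (auto simp: dd1_eq lift_def qzero_def fun_eq_iff)
  ultimately show ?thesis unfolding K1_def by (simp add: mem_Times_iff)
qed

lemma Phi_lift:
  assumes "y \<in> O_carrier Ux Uy"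
  shows "Phi (lift y) = y"
proof -
  have y: "fst y holomorphic_on Ux" "snd y holomorphic_on Uy"
    "\<And>z. z \<notin> Ux \<Longrightarrow> fst y z = 0" "\<And>w. w \<notin> Uy \<Longrightarrow> snd y w = 0"
    using assms by (auto simp: O_carrier_def)
  have "div0 (eta_trace (lift y)) z = q ^ d / q ^ l * fst y z" if z: "z \<in> Ux" for z
    by (rule div0_eqI[OF open_U(1) zero_U(1) _ _ z])
       (auto intro!: holomorphic_intros y simp: eta_trace_def lift_def)
  moreover have "div0 (zeta_trace (lift y)) w = snd y w" if w: "w \<in> Uy" for w
    by (rule div0_eqI[OF open_U(2) zero_U(2) _ _ w])
       (auto intro!: y simp: zeta_trace_def lift_def)
  ultimately show ?thesis by (simp add: Phi_def prod_eq_iff fun_eq_iff y)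
qed

lemma continuous_map_Phi:
  "continuous_map (subtopology (QQ_top Ux Uy) K1) (O_top Ux Uy) Phi"
proof -
  let ?X = "subtopology (QQ_top Ux Uy) K1"
  have ts: "topspace ?X = K1" by (auto simp: K1_def)
  have 1: "continuous_map ?X (Q_top Ux Uy) fst" and 2: "continuous_map ?X (Q_top Ux Uy) snd"
    by (intro continuous_map_from_subtopology continuous_map_QQ_top_proj)+
  have "continuous_map ?X (lcu_topology Ux) eta_trace" unfolding eta_trace_def[abs_def]
    by (rule continuous_map_lcu_reindex[OF continuous_map_Q_top_proj(1)[OF 2]])
       (auto intro!: continuous_intros)
  then have "continuous_map ?X (lcu_topology Ux) (\<lambda>p. div0 (eta_trace p))"
    by (rule continuous_map_lcu_div0[OF open_U(1) zero_U(1)])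
       (unfold ts, auto simp: K1_def trace_holomorphic trace_zero)
  then have x: "continuous_map ?X (lcu_topology Ux) (\<lambda>p z. q ^ l / q ^ d * div0 (eta_trace p) z)"
    by (rule continuous_map_lcu_mult) (rule continuous_on_const)
  have "continuous_map ?X (lcu_topology Uy) zeta_trace" unfolding zeta_trace_def[abs_def]
    by (rule continuous_map_lcu_reindex[OF continuous_map_Q_top_proj(4)[OF 1]])
       (auto intro!: continuous_intros)
  then have y: "continuous_map ?X (lcu_topology Uy) (\<lambda>p. div0 (zeta_trace p))"
    by (rule continuous_map_lcu_div0[OF open_U(2) zero_U(2)])
       (unfold ts, auto simp: K1_def trace_holomorphic trace_zero)
  show ?thesis unfolding Phi_def[abs_def]
  proof (rule continuous_map_into_O_top)
    show "(\<lambda>z. if z \<in> Ux then q ^ l / q ^ d * div0 (eta_trace p) z else 0,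
         \<lambda>w. if w \<in> Uy then div0 (zeta_trace p) w else 0) \<in> O_carrier Ux Uy" if "p \<in> topspace ?X" for p
      using Phi_in[of p] that unfolding ts Phi_def .
  qed (auto intro: continuous_map_lcu_cong[OF x] continuous_map_lcu_cong[OF y])
qed

lemma continuous_map_lift:
  "continuous_map (O_top Ux Uy) (subtopology (QQ_top Ux Uy) K1) lift"
proof (rule continuous_map_into_subtopology)
  have in_Q: "fst (lift y) \<in> \<Q>" "snd (lift y) \<in> \<Q>" if "y \<in> O_carrier Ux Uy" for y
    using lift_in[OF that] by (auto simp: K1_def)
  note x = continuous_map_lcu_reindex[OF continuous_map_O_top_proj(1)]
  note y = continuous_map_lcu_reindex[OF continuous_map_O_top_proj(2)]
  let ?T = "O_top Ux Uy"
  have F: "continuous_map ?T (lcu_topology (Ux \<times> S)) (\<lambda>y p. fst y (fst p))" for S :: "complex set"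
    by (rule x) (auto intro!: continuous_intros)
  have G: "continuous_map ?T (lcu_topology (S \<times> Uy)) (\<lambda>y p. snd y (snd p))" for S
    by (rule y) (auto intro!: continuous_intros)
  have F0: "continuous_map ?T (lcu_topology (Ux \<times> Uy)) (\<lambda>y p. fst y 0)"
    by (rule x) (auto intro!: continuous_intros)
  have A: "continuous_map ?T (lcu_topology (Ux \<times> Uy)) (\<lambda>y p. fst y (fst p) + snd y (snd p) - fst y 0)"
    by (intro continuous_map_lcu_diff continuous_map_lcu_add F G F0)
  show "continuous_map ?T (QQ_top Ux Uy) lift"
    unfolding QQ_top_def lift_def[abs_def]
  proof (intro continuous_map_pairedI continuous_map_into_Q_top continuous_map_lcu_const)
    show "continuous_map ?T (lcu_topology (Ux \<times> Uy))
        (\<lambda>y p. if p \<in> Ux \<times> Uy then snd p * (fst y (fst p) + snd y (snd p) - fst y 0) else 0)"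
      by (rule continuous_map_lcu_cong[OF continuous_map_lcu_mult[OF A, of snd]])
         (auto intro!: continuous_intros)
    show "continuous_map ?T (lcu_topology (Uy \<times> Uy))
        (\<lambda>y p. if p \<in> Uy \<times> Uy then snd p * snd y (snd p) else 0)"
      by (rule continuous_map_lcu_cong[OF continuous_map_lcu_mult[OF G, of _ snd]])
         (auto intro!: continuous_intros)
    show "continuous_map ?T (lcu_topology (Ux \<times> Ux))
        (\<lambda>y p. if p \<in> Ux \<times> Ux then q ^ d / q ^ l * (fst p * fst y (fst p)) else 0)"
      by (rule continuous_map_lcu_cong[OF continuous_map_lcu_mult[OF F, of _ "\<lambda>p. q ^ d / q ^ l * fst p"]])
         (auto intro!: continuous_intros)
    show "continuous_map ?T (lcu_topology (Ux \<times> Uy))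
        (\<lambda>y p. if p \<in> Ux \<times> Uy then q ^ d / q ^ l * (fst p * (fst y (fst p) + snd y (snd p) - fst y 0)) else 0)"
      by (rule continuous_map_lcu_cong[OF continuous_map_lcu_mult[OF A, of "\<lambda>p. q ^ d / q ^ l * fst p"]])
         (auto intro!: continuous_intros)
  qed (use in_Q in \<open>simp_all add: lift_def\<close>)
  show "lift \<in> topspace ?T \<rightarrow> K1" using lift_in by auto
qed

text \<open>The continuous right inverse \<open>lift\<close> does the work of an open mapping
  theorem: it makes the algebraic isomorphism of cocycles modulo coboundaries with
  \<open>O(U)\<close> a homeomorphism for the quotient topology.\<close>

lemma quotient_map_Phi: "quotient_map (subtopology (QQ_top Ux Uy) K1) (O_top Ux Uy) Phi"
  by (rule retraction_imp_quotient_map)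
     (use continuous_map_Phi continuous_map_lift Phi_lift in \<open>auto simp: retraction_map_def retraction_maps_def\<close>)

lemma Phi_image: "Phi ` K1 = O_carrier Ux Uy"
proof
  show "Phi ` K1 \<subseteq> O_carrier Ux Uy" using Phi_in by blast
  show "O_carrier Ux Uy \<subseteq> Phi ` K1"
  proof
    fix y assume y: "y \<in> O_carrier Ux Uy"
    show "y \<in> Phi ` K1"
      by (rule image_eqI[where x = "lift y"]) (simp_all add: Phi_lift[OF y] lift_in[OF y])
  qed
qed

end

theorem theorem4p1:
  fixes q :: complex and Ux Uy :: "complex set" and d l :: nat
  assumes "0 < norm q" and "norm q < 1"
    and "q_open q Ux" and "q_open q Uy"
  shows
    "continuous_map (Q_top Ux Uy) (QQ_top Ux Uy) (dd0 q d l) \<and>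
     continuous_map (QQ_top Ux Uy) (Q_top Ux Uy) (dd1 q d l) \<and>
     continuous_map (Q_top Ux Uy) (O_top Ux Uy) (pi_dl q d l Ux Uy) \<and>
     (\<forall>x\<in>Q_carrier Ux Uy. dd1 q d l (dd0 q d l x) = qzero) \<and>
     (\<forall>p\<in>Q_carrier Ux Uy \<times> Q_carrier Ux Uy. pi_dl q d l Ux Uy (dd1 q d l p) = ozero) \<and>
     (\<forall>x\<in>Q_carrier Ux Uy. dd0 q d l x = (qzero, qzero) \<longrightarrow> x = qzero) \<and>
     (let K1 = {p \<in> Q_carrier Ux Uy \<times> Q_carrier Ux Uy. dd1 q d l p = qzero} in
       \<exists>\<Phi> :: quad \<times> quad \<Rightarrow> ofun.
         \<Phi> ` K1 = O_carrier Ux Uy \<and>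
         (\<forall>c. \<forall>x\<in>K1. \<forall>y\<in>K1.
            \<Phi> (qadd (qscale c (fst x)) (fst y), qadd (qscale c (snd x)) (snd y))
              = oadd (oscale c (\<Phi> x)) (\<Phi> y)) \<and>
         {p \<in> K1. \<Phi> p = ozero} = dd0 q d l ` Q_carrier Ux Uy \<and>
         quotient_map (subtopology (QQ_top Ux Uy) K1) (O_top Ux Uy) \<Phi>) \<and>
     {x \<in> Q_carrier Ux Uy. pi_dl q d l Ux Uy x = ozero} = dd1 q d l ` (Q_carrier Ux Uy \<times> Q_carrier Ux Uy) \<and>
     pi_dl q d l Ux Uy ` Q_carrier Ux Uy = O_carrier Ux Uy"
proof -
  interpret q_open_cross q Ux Uy d l using assms by unfold_locales
  have ker_Phi_eq: "{p \<in> K1. Phi p = ozero} = dd0 q d l ` \<Q>"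
    using dd0_in_ker_Phi ker_Phi by blast
  have dd1_in': "dd1 q d l p \<in> \<Q>" if "p \<in> \<Q> \<times> \<Q>" for p
    using that dd1_in[of "fst p" "snd p"] by (simp add: mem_Times_iff)
  have "{x \<in> \<Q>. pi_dl q d l Ux Uy x = ozero} = dd1 q d l ` (\<Q> \<times> \<Q>)"
    using ker_pi pi_dd1 dd1_in' by blast
  moreover have "pi_dl q d l Ux Uy ` \<Q> = O_carrier Ux Uy"
    using pi_in pi_surj by blast
  moreover have "let K1 = {p \<in> \<Q> \<times> \<Q>. dd1 q d l p = qzero} in
       \<exists>\<Phi> :: quad \<times> quad \<Rightarrow> ofun.
         \<Phi> ` K1 = O_carrier Ux Uy \<and>
         (\<forall>c. \<forall>x\<in>K1. \<forall>y\<in>K1.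
            \<Phi> (qadd (qscale c (fst x)) (fst y), qadd (qscale c (snd x)) (snd y))
              = oadd (oscale c (\<Phi> x)) (\<Phi> y)) \<and>
         {p \<in> K1. \<Phi> p = ozero} = dd0 q d l ` \<Q> \<and>
         quotient_map (subtopology (QQ_top Ux Uy) K1) (O_top Ux Uy) \<Phi>"
    unfolding Let_def K1_def[symmetric]
    by (intro exI[of _ Phi] conjI allI ballI Phi_image Phi_linear ker_Phi_eq quotient_map_Phi)
  ultimately show ?thesis
    using continuous_map_dd0 continuous_map_dd1 continuous_map_pi dd1_dd0 pi_dd1 dd0_inj
    by (intro conjI ballI impI)
qed

end
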